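(* Let $d\ge 1$ and $M \ge 1$ be integers, let $p\in \mathbb{R}[x_1,\dots,x_d]$ have degree at most $2M$, and let $t\in [0,1)$ and $\epsilon \in (0,\infty)$. Assume that $p(\xi) \ge 0$ for all $\xi \in \mathbb{R}^d$ and set $$\mu := M\,\binom{2M+d-1}{d-1}^{\frac{1}{2}} 2^{M+\frac12} \in (0,\infty).$$ Let $N_{\mathrm{expl}} \in \mathbb{N}_0$ be the maximum of $$2M + \Bigl\lceil \frac{5d}{2} \Bigr\rceil + 2$$ and $$\Bigl\lceil 2\mathrm{e} \bigl( 4\mu\,\|p/\epsilon\| \bigr)^{\frac{1}{1-t}} \Bigr\rceil + \max\Bigl\{ 0 , \Bigl\lceil \frac{1}{1-t} \ln\Bigl( \frac{ (d+1)^2\,2^{2d}\, \|p / \epsilon\| }{ \mu } \Bigr) \Bigr\rceil \Bigr\} + \Bigl\lfloor \frac{3d}{2} \Bigr\rfloor + 1 ,$$ where $\mathrm{e}$ is Euler's number. Then $$p + \epsilon \sum_{n=0}^{N_{\mathrm{expl}}} \frac{1}{(n!)^t} \Bigl(\sum_{j=1}^d x_j^2 \Bigr)^n$$ is a sum of squares of polynomials in $\mathbb{R}[x_1,\dots,x_d]$.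
   Context: $\mathbb{N}_0=\{0,1,2,\dots\}$. For $p\in\mathbb{R}[x_1,\dots,x_d]$ and $\alpha\in\mathbb{N}_0^d$, $[p]_\alpha$ denotes the coefficient of $x^\alpha=\prod_j x_j^{\alpha_j}$ in $p$, and $\alpha!=\prod_j\alpha_j!$. The norm is $\|p\| := \sum_{\alpha \in \mathbb{N}_0^d} |[p]_\alpha|\, (\alpha !)^{1/2}$. If $p=0$, the convention $\ln 0=-\infty$ is used, so that the maximum $\max\{0,\dots\}$ equals $0$. *)

theory Defs
  imports "HOL-Analysis.Analysis" "HOL-Library.Poly_Mapping"
begin

text \<open>
  The ring of real polynomials in \<open>d\<close> variables is modelled by finitely supported functions from
  exponent vectors to coefficients, with the convolution product of \<open>Poly_Mapping\<close>.  The variables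
  are indexed by a finite type \<open>'d\<close>, so that \<open>d = CARD('d) \<ge> 1\<close>.  The coefficient \<open>[p]\<^sub>\<alpha>\<close>
  is \<open>lookup p \<alpha>\<close>.
\<close>

type_synonym 'd mpoly = "('d \<Rightarrow>\<^sub>0 nat) \<Rightarrow>\<^sub>0 real"

definition pvar :: "'d \<Rightarrow> 'd mpoly"
  where "pvar j = Poly_Mapping.single (Poly_Mapping.single j 1) 1"

definition pconst :: "real \<Rightarrow> 'd mpoly"
  where "pconst c = Poly_Mapping.single 0 c"

definition peval :: "(real ^ 'd) \<Rightarrow> ('d::finite) mpoly \<Rightarrow> real"
  where "peval \<xi> p =
    (\<Sum>\<alpha>\<in>Poly_Mapping.keys p. Poly_Mapping.lookup p \<alpha> * (\<Prod>j\<in>UNIV. (\<xi> $ j) ^ Poly_Mapping.lookup \<alpha> j))"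

text \<open>The total degree; the zero polynomial is assigned degree \<open>0\<close>.\<close>

definition pdegree :: "('d::finite) mpoly \<Rightarrow> nat"
  where "pdegree p =
    Max (insert 0 ((\<lambda>\<alpha>. \<Sum>j\<in>UNIV. Poly_Mapping.lookup \<alpha> j) ` Poly_Mapping.keys p))"

definition mfact :: "(('d::finite) \<Rightarrow>\<^sub>0 nat) \<Rightarrow> real"
  where "mfact \<alpha> = (\<Prod>j\<in>UNIV. fact (Poly_Mapping.lookup \<alpha> j))"

definition pnorm :: "('d::finite) mpoly \<Rightarrow> real"
  where "pnorm p = (\<Sum>\<alpha>\<in>Poly_Mapping.keys p. \<bar>Poly_Mapping.lookup p \<alpha>\<bar> * sqrt (mfact \<alpha>))"

definition is_sos :: "'d mpoly \<Rightarrow> bool"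
  where "is_sos p \<longleftrightarrow> (\<exists>qs :: 'd mpoly list. p = (\<Sum>q\<leftarrow>qs. q ^ 2))"

definition mu :: "nat \<Rightarrow> nat \<Rightarrow> real"
  where "mu d M = real M * sqrt (real ((2 * M + d - 1) choose (d - 1))) * 2 powr (real M + 1 / 2)"

text \<open>
  The two numbers whose maximum is \<open>N_expl\<close>, in dimension \<open>d\<close>.  The argument \<open>s\<close>
  stands for the norm of \<open>p / \<epsilon>\<close>; it vanishes exactly if \<open>p = 0\<close>, in which case \<open>ln 0\<close> is to be
  read as \<open>-\<infinity>\<close> (and not as the value that the library assigns to it).
\<close>

definition N_first :: "nat \<Rightarrow> nat \<Rightarrow> int"
  where "N_first d M = 2 * int M + \<lceil>5 * real d / 2\<rceil> + 2"

definition N_second :: "nat \<Rightarrow> nat \<Rightarrow> real \<Rightarrow> real \<Rightarrow> int"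
  where "N_second d M t s =
    \<lceil>2 * exp 1 * (4 * mu d M * s) powr (1 / (1 - t))\<rceil>
    + (if s = 0 then 0
       else max 0 \<lceil>1 / (1 - t) * ln ((real d + 1)\<^sup>2 * 2 ^ (2 * d) * s / mu d M)\<rceil>)
    + \<lfloor>3 * real d / 2\<rfloor> + 1"

definition N_expl :: "nat \<Rightarrow> real \<Rightarrow> real \<Rightarrow> ('d::finite) mpoly \<Rightarrow> nat"
  where "N_expl M t \<epsilon> p =
    nat (max (N_first CARD('d) M) (N_second CARD('d) M t (pnorm (pconst (1 / \<epsilon>) * p))))"

lemma mu_pos: "M \<ge> 1 \<Longrightarrow> d \<ge> 1 \<Longrightarrow> mu d M > 0"
  by (auto simp: mu_def intro!: mult_pos_pos)

lemma int_N_expl: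
  fixes p :: "('d::finite) mpoly"
  shows "int (N_expl M t \<epsilon> p) =
    max (N_first CARD('d) M) (N_second CARD('d) M t (pnorm (pconst (1 / \<epsilon>) * p)))"
proof -
  have "\<lceil>5 * real CARD('d) / 2\<rceil> \<ge> 0" by (simp add: less_le_trans[of _ 0])
  then have "N_first CARD('d) M \<ge> 0" by (simp add: N_first_def)
  then show ?thesis by (simp add: N_expl_def)
qed

lemma mfact_pos: "mfact \<alpha> > 0"
  by (auto simp: mfact_def intro!: prod_pos)

lemma pnorm_eq_0_iff: "pnorm p = 0 \<longleftrightarrow> p = 0"
proof
  assume "pnorm p = 0"
  then have "\<forall>\<alpha>\<in>Poly_Mapping.keys p. \<bar>Poly_Mapping.lookup p \<alpha>\<bar> * sqrt (mfact \<alpha>) = 0"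
    unfolding pnorm_def
    by (subst (asm) sum_nonneg_eq_0_iff) (auto simp: less_imp_le[OF mfact_pos])
  then have "Poly_Mapping.keys p = {}"
    using mfact_pos by (fastforce simp: in_keys_iff less_le)
  then show "p = 0" by simp
qed (simp add: pnorm_def)

lemma lookup_pconst_mult:
  "Poly_Mapping.lookup (pconst c * p) \<alpha> = c * Poly_Mapping.lookup p \<alpha>"
  by (simp add: pconst_def Poly_Mapping.map.rep_eq when_def flip: mult_map_scale_conv_mult)

end

theory Submission
  imports Defs "HOL-Probability.Distributions" "HOL-Computational_Algebra.Polynomial"
begin

text \<open>
  Dividing by \<open>\<epsilon>\<close> reduces the claim to \<open>\<epsilon> = 1\<close>.  Write \<open>S\<close> for the norm of \<open>p\<close> and \<open>P\<close> for the
  perturbing sum.  By the multinomial theorem, \<open>P\<close> dominates every \<open>|\<alpha>|!\<^bsup>1-t\<^esup> x\<^bsup>2\<alpha>\<^esup> / \<alpha>!\<close> with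
  \<open>|\<alpha>| \<le> N\<close> up to sums of squares.  By the inequality of arithmetic and geometric means,
  \<open>c x\<^bsup>\<alpha>+\<beta>\<^esup> + K P\<close> is therefore a sum of squares whenever
  \<open>|c| \<surd>(\<alpha>! \<beta>!) \<le> K \<surd>(|\<alpha>|!\<^bsup>1-t\<^esup> |\<beta>|!\<^bsup>1-t\<^esup>)\<close> (\<open>is_sos_mon_add_penalty\<close>).  In particular
  \<open>q + \<parallel>q\<parallel> P\<close> is a sum of squares for every \<open>q\<close> of degree at most \<open>2 N\<close>
  (\<open>is_sos_low_degree_add_penalty\<close>), which settles the case \<open>S \<le> 1\<close>.

  If \<open>S > 1\<close>, the nonnegativity of \<open>p\<close> enters through the heat kernel with variance \<open>s\<close>.  Up to
  a factor depending only on \<open>\<xi>\<close>, the kernel \<open>exp (- |x - \<xi>|\<^sup>2 / (2 s))\<close> is the square of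
  \<open>exp ((2 x \<cdot> \<xi> - |x|\<^sup>2) / (4 s)) = \<Sum>\<^sub>\<alpha> g\<^sub>\<alpha>(\<xi>) x\<^sup>\<alpha>\<close>.  The matrix
  \<open>C\<^bsub>\<alpha>\<beta>\<^esub> = E (p g\<^sub>\<alpha> g\<^sub>\<beta>)\<close>, for a centred Gaussian vector of covariance \<open>s\<close> times the identity, is
  positive semidefinite (\<open>hcoeff_psd\<close>), so that \<open>Q = \<Sum> C\<^bsub>\<alpha>\<beta>\<^esub> x\<^bsup>\<alpha>+\<beta>\<^esup>\<close>, summed over
  \<open>|\<alpha>|, |\<beta>| \<le> N\<close>, is a sum of squares.  It remains to compare \<open>p\<close> with \<open>Q\<close>.

  In degrees up to \<open>N\<close> the truncation is invisible, and \<open>Q\<close> agrees with the heat flow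
  \<open>E p(x + \<xi>)\<close> (\<open>sum_hcoeff_antidiagonal\<close>).  Its distance from \<open>p\<close> in the norm is at most
  \<open>(exp (s M) - 1) S\<close> (\<open>heat_diff_norm_le\<close>), which is at most \<open>1/2\<close> for \<open>s = 1 / (4 M S)\<close>.

  The terms with \<open>n = |\<alpha>| + |\<beta>| > N\<close> satisfy \<open>|C\<^bsub>\<alpha>\<beta>\<^esub>| \<surd>(\<alpha>! \<beta>!) \<le> S (3 M S)\<^bsup>n/2\<^esup>\<close>
  (\<open>abs_hcoeff_le\<close>).  Let \<open>X = 4 \<mu> S\<close>.  As \<open>\<mu> \<ge> 2 d M\<close>, the right-hand side is at most
  \<open>S (2/3)\<^sup>n X\<^bsup>n/2\<^esup>\<close>, and \<open>n \<ge> 2 e X\<^bsup>1/(1-t)\<^esup>\<close> yields \<open>X\<^sup>n \<le> |\<alpha>|!\<^bsup>1-t\<^esup> |\<beta>|!\<^bsup>1-t\<^esup>\<close>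
  (\<open>power_le_fact_powr\<close>).  Every such term is thus absorbed by \<open>S (2/3)\<^sup>N P\<close>, and since \<open>N\<close> is at
  least \<open>16 e d S\<close>, all of them together by \<open>P / 2\<close> (\<open>tail_small\<close>).
\<close>

section \<open>Gaussian moments in one variable\<close>

text \<open>The centred Gaussian measure on the line with variance \<open>s\<close>, its moments and its expectation.\<close>

definition gauss :: "real \<Rightarrow> real measure"
  where "gauss s = density lborel (normal_density 0 (sqrt s))"

definition gmom :: "real \<Rightarrow> nat \<Rightarrow> real"
  where "gmom s n = (if even n then (s / 2) ^ (n div 2) * fact n / fact (n div 2) else 0)"

definition gexp :: "real \<Rightarrow> real poly \<Rightarrow> real"
  where "gexp s q = (\<integral>x. poly q x \<partial>gauss s)"

lemma prob_space_gauss: "s > 0 \<Longrightarrow> prob_space (gauss s)"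
  unfolding gauss_def by (rule prob_space_normal_density) simp

lemma sets_gauss [simp, measurable_cong]: "sets (gauss s) = sets borel"
  by (simp add: gauss_def)

lemma gmom_has_integral:
  assumes "s > 0"
  shows "has_bochner_integral (gauss s) (\<lambda>x. x ^ n) (gmom s n)"
proof -
  have sq: "(sqrt s)\<^sup>2 = s" using assms by simp
  have "has_bochner_integral lborel (\<lambda>x. normal_density 0 (sqrt s) x *\<^sub>R x ^ n) (gmom s n)"
  proof (cases "even n")
    case True
    then obtain k where "n = 2 * k" by (elim evenE)
    then show ?thesis
      using normal_moment_even[of "sqrt s" 0 k] assms sq
      by (simp add: gmom_def field_simps)
  next
    case False
    then obtain k where "n = 2 * k + 1" by (elim oddE)
    then show ?thesis
      using normal_moment_odd[of "sqrt s" 0 k] assms by (simp add: gmom_def)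
  qed
  then show ?thesis
    unfolding gauss_def by (intro has_bochner_integral_density) auto
qed

lemma integrable_poly_gauss:
  assumes "s > 0"
  shows "integrable (gauss s) (poly q)"
proof -
  have "integrable (gauss s) (\<lambda>x. \<Sum>i\<le>degree q. coeff q i * x ^ i)"
    using gmom_has_integral[OF assms]
    by (intro Bochner_Integration.integrable_sum integrable_mult_right)
       (auto simp: has_bochner_integral_iff)
  then show ?thesis by (simp add: poly_altdef[abs_def])
qed

lemma gexp_add: "s > 0 \<Longrightarrow> gexp s (p + q) = gexp s p + gexp s q"
  by (simp add: gexp_def integrable_poly_gauss)

lemma gexp_diff: "s > 0 \<Longrightarrow> gexp s (p - q) = gexp s p - gexp s q"
  by (simp add: gexp_def integrable_poly_gauss)

lemma gexp_smult: "gexp s (smult c q) = c * gexp s q"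
  by (simp add: gexp_def)

lemma gexp_0 [simp]: "gexp s 0 = 0"
  by (simp add: gexp_def)

lemma gexp_monom: "s > 0 \<Longrightarrow> gexp s (monom c n) = c * gmom s n"
  using gmom_has_integral[of s n]
  by (simp add: gexp_def poly_monom has_bochner_integral_iff)

lemma gmom_Suc: "gmom s (Suc n) = s * real n * gmom s (n - 1)"
proof (cases "even n")
  case True
  then show ?thesis by (cases n) (auto simp: gmom_def)
next
  case False
  then obtain k where n: "n = 2 * k + 1" by (elim oddE)
  define F where "F = (fact (2 * k) / fact k :: real)"
  have "fact (2 * k + 2) / fact (k + 1) = 2 * real (2 * k + 1) * F"
    by (simp add: F_def divide_simps) (simp add: algebra_simps)
  then have "(s / 2) ^ (k + 1) * (fact (2 * k + 2) / fact (k + 1)) = s * real n * ((s / 2) ^ k * F)"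
    unfolding n by simp
  then show ?thesis
    unfolding gmom_def n F_def by (simp del: fact_Suc)
qed


text \<open>Gaussian integration by parts.\<close>

lemma gexp_pCons_0:
  assumes "s > 0"
  shows "gexp s (pCons 0 q) = s * gexp s (pderiv q)"
proof -
  have "gexp s (pCons 0 (\<Sum>i\<in>I. monom (c i) i)) = s * gexp s (pderiv (\<Sum>i\<in>I. monom (c i) i))"
    if "finite I" for I :: "nat set" and c
    using that
  proof induction
    case (insert i I)
    have "gexp s (pCons 0 (monom (c i) i)) = s * gexp s (pderiv (monom (c i) i))"
      using assms by (simp flip: monom_Suc add: pderiv_monom gexp_monom gmom_Suc)
    moreover have "pCons 0 (a + b) = pCons 0 a + pCons 0 b" for a b :: "real poly"
      by simp
    ultimately show ?case
      using insert by (simp add: gexp_add[OF assms] pderiv_add distrib_left del: add_pCons)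
  qed simp
  from this[of "{..degree q}" "coeff q"] show ?thesis
    by (simp add: poly_as_sum_of_monoms)
qed

lemma gmom_nonneg: "s > 0 \<Longrightarrow> gmom s n \<ge> 0"
  by (simp add: gmom_def)

lemma gmom_le:
  assumes "s > 0"
  shows "gmom s n \<le> sqrt s ^ n * sqrt (fact n)"
proof (cases "even n")
  case False
  then show ?thesis using assms by (simp add: gmom_def)
next
  case True
  then obtain k where n: "n = 2 * k" by (elim evenE)
  have "fact (2 * k) = fact k * fact k * real ((2 * k) choose k)"
    using binomial_fact_lemma[of k "2 * k"]
    by (metis (no_types) add_diff_cancel_left' le_add2 mult_2 of_nat_fact of_nat_mult)
  also have "real ((2 * k) choose k) \<le> 2 ^ (2 * k)"
    using binomial_le_pow2[of "2 * k" k] by (metis of_nat_le_iff of_nat_numeral of_nat_power)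
  finally have *: "fact (2 * k) \<le> (2 ^ k * fact k :: real)\<^sup>2"
    by (simp add: power_mult_distrib power2_eq_square mult_left_mono mult_ac power_mult)
  have "fact (2 * k) = sqrt (fact (2 * k)) * sqrt (fact (2 * k))" by simp
  also have "\<dots> \<le> sqrt (fact (2 * k)) * (2 ^ k * fact k)"
    using * by (intro mult_left_mono real_le_lsqrt) auto
  finally have "fact (2 * k) / (2 ^ k * fact k) \<le> sqrt (fact (2 * k))"
    by (simp add: field_simps)
  then have "s ^ k * (fact (2 * k) / (2 ^ k * fact k)) \<le> s ^ k * sqrt (fact (2 * k))"
    using assms by (intro mult_left_mono) auto
  moreover have "sqrt s ^ (2 * k) = s ^ k"
    using assms by (simp add: power_mult)
  ultimately show ?thesis
    unfolding n gmom_def by (simp add: power_divide mult_ac)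
qed

text \<open>
  The Taylor coefficients in \<open>x\<close> of \<open>exp ((2 x \<xi> - x\<^sup>2) / (4 s))\<close>, as polynomials in \<open>\<xi>\<close>.  The
  square of this generating function is, up to a factor depending only on \<open>\<xi>\<close>, the heat kernel
  \<open>exp (- (x - \<xi>)\<^sup>2 / (2 s))\<close>.
\<close>

fun hg :: "real \<Rightarrow> nat \<Rightarrow> real poly"
  where
    "hg s 0 = 1"
  | "hg s (Suc 0) = [:0, 1 / (2 * s):]"
  | "hg s (Suc (Suc n)) =
      smult (1 / (2 * s * real (n + 2))) (pCons 0 (hg s (Suc n)) - hg s n)"

text \<open>Values at negative indices are zero; \<open>prev f n\<close> stands for \<open>f (n - 1)\<close> in this sense.\<close>

definition prev :: "(nat \<Rightarrow> 'a::zero) \<Rightarrow> nat \<Rightarrow> 'a"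
  where "prev f n = (if n = 0 then 0 else f (n - 1))"

lemma prev_0 [simp]: "prev f 0 = 0" and prev_Suc [simp]: "prev f (Suc n) = f n"
  by (simp_all add: prev_def)

lemma hg_rec:
  assumes "s > 0"
  shows "smult (real (Suc n)) (hg s (Suc n)) =
    smult (1 / (2 * s)) (pCons 0 (hg s n) - prev (hg s) n)"
  using assms by (cases n) (simp_all add: divide_simps)

lemma pderiv_hg:
  assumes "s > 0"
  shows "pderiv (hg s n) = smult (1 / (2 * s)) (prev (hg s) n)"
proof (induction n rule: less_induct)
  case (less n)
  consider "n = 0" | "n = 1" | k where "n = Suc (Suc k)"
    by (metis One_nat_def not0_implies_Suc)
  then show ?case
  proof cases
    case (3 k)
    have "smult (real (Suc (Suc k))) (pderiv (hg s n)) = pderiv (smult (real (Suc (Suc k))) (hg s n))"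
      by (simp add: pderiv_smult)
    also have "\<dots> = smult (1 / (2 * s)) (hg s (Suc k) + (pCons 0 (pderiv (hg s (Suc k))) - pderiv (hg s k)))"
      unfolding 3 hg_rec[OF assms] by (simp add: pderiv_smult pderiv_diff pderiv_pCons add_diff_eq)
    also have "pCons 0 (pderiv (hg s (Suc k))) - pderiv (hg s k) =
        smult (1 / (2 * s)) (pCons 0 (hg s k) - prev (hg s) k)"
      using less.IH[of "Suc k"] less.IH[of k] 3 by (simp add: smult_diff_right)
    also have "\<dots> = smult (real (Suc k)) (hg s (Suc k))"
      by (rule hg_rec[OF assms, symmetric])
    finally have "smult (real (Suc (Suc k))) (pderiv (hg s n)) =
        smult (1 / (2 * s)) (hg s (Suc k) + smult (real (Suc k)) (hg s (Suc k)))" .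
    also have "hg s (Suc k) + smult (real (Suc k)) (hg s (Suc k)) = smult (real (Suc (Suc k))) (hg s (Suc k))"
      by (metis add.commute of_nat_Suc smult_1_left smult_add_left)
    finally have "smult (real (Suc (Suc k))) (pderiv (hg s n)) =
        smult (real (Suc (Suc k))) (smult (1 / (2 * s)) (hg s (Suc k)))"
      by (simp add: mult.commute)
    then show ?thesis
      using 3 by (metis of_nat_eq_0_iff nat.distinct(1) smult_cancel prev_Suc)
  qed (simp_all add: pderiv_pCons)
qed

text \<open>The Gaussian expectation of \<open>\<xi>\<^sup>m\<close> times the product of two of these polynomials.\<close>

definition hmom :: "real \<Rightarrow> nat \<Rightarrow> nat \<Rightarrow> nat \<Rightarrow> real"
  where "hmom s m i j = gexp s (monom 1 m * hg s i * hg s j)"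

lemma hmom_sym: "hmom s m i j = hmom s m j i"
  by (simp add: hmom_def mult_ac)

lemma hmom_0_0: "s > 0 \<Longrightarrow> hmom s m 0 0 = gmom s m"
  by (simp add: hmom_def gexp_monom)

text \<open>
  This combines the recurrence \<open>hg_rec\<close>, integration by parts and \<open>pderiv_hg\<close>.
\<close>

lemma hmom_rec:
  assumes "s > 0"
  shows "real (Suc i) * hmom s m (Suc i) j =
    real m / 2 * hmom s (m - 1) i j
    + (prev (hmom s m i) j - prev (\<lambda>i. hmom s m i j) i) / (4 * s)"
proof -
  define f where "f = monom 1 m * hg s i * hg s j"
  have prev1: "prev (hmom s m i) j = gexp s (monom 1 m * hg s i * prev (hg s) j)"
    and prev2: "prev (\<lambda>i. hmom s m i j) i = gexp s (monom 1 m * prev (hg s) i * hg s j)"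
    by (simp_all add: prev_def hmom_def)
  have "real (Suc i) * hmom s m (Suc i) j = gexp s (monom 1 m * smult (real (Suc i)) (hg s (Suc i)) * hg s j)"
    by (simp add: hmom_def gexp_smult del: hg.simps)
  also have "\<dots> = (gexp s (pCons 0 f) - prev (\<lambda>i. hmom s m i j) i) / (2 * s)"
  proof -
    have "pCons 0 f = monom 1 m * pCons 0 (hg s i) * hg s j"
      by (simp add: f_def)
    then have "monom 1 m * smult (real (Suc i)) (hg s (Suc i)) * hg s j =
        smult (1 / (2 * s)) (pCons 0 f - monom 1 m * prev (hg s) i * hg s j)"
      unfolding hg_rec[OF assms]
      by (simp only: mult_smult_right mult_smult_left left_diff_distrib right_diff_distrib)
    then show ?thesis
      unfolding prev2 by (simp only: gexp_smult gexp_diff[OF assms]) simp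
  qed
  also have "gexp s (pCons 0 f) = s * gexp s (pderiv f)"
    by (rule gexp_pCons_0[OF assms])
  also have "pderiv f = smult (real m) (monom 1 (m - 1) * hg s i * hg s j)
      + smult (1 / (2 * s)) (monom 1 m * prev (hg s) i * hg s j)
      + smult (1 / (2 * s)) (monom 1 m * hg s i * prev (hg s) j)"
  proof -
    have "pderiv (monom (1::real) m) = smult (real m) (monom 1 (m - 1))"
      by (simp add: pderiv_monom smult_monom)
    then show ?thesis
      unfolding f_def pderiv_mult pderiv_hg[OF assms]
      by (simp only: mult_smult_right mult_smult_left distrib_left mult.assoc mult.left_commute
        mult.commute add_ac)
  qed
  also have "gexp s \<dots> = real m * hmom s (m - 1) i j
      + (prev (\<lambda>i. hmom s m i j) i + prev (hmom s m i) j) / (2 * s)"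
    unfolding prev1 prev2
    by (simp add: gexp_add[OF assms] gexp_smult hmom_def add_divide_distrib)
  finally have "real (Suc i) * hmom s m (Suc i) j =
      (s * (real m * hmom s (m - 1) i j + (prev (\<lambda>i. hmom s m i j) i + prev (hmom s m i) j) / (2 * s))
      - prev (\<lambda>i. hmom s m i j) i) / (2 * s)" .
  moreover have "(s * (x + (a + b) / (2 * s)) - a) / (2 * s) = x / 2 + (b - a) / (4 * s)" for x a b
    using assms by (simp add: field_simps)
  ultimately show ?thesis by simp
qed

text \<open>
  Summation over an antidiagonal amounts to squaring the generating function: the sum is the
  coefficient of \<open>x\<^sup>n\<close> in the heat flow \<open>E (x + \<xi>)\<^sup>m\<close> of \<open>x\<^sup>m\<close>.
\<close>

lemma sum_hmom_antidiagonal: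
  assumes "s > 0"
  shows "(\<Sum>i\<le>n. hmom s m i (n - i)) = real (m choose n) * gmom s (m - n)"
proof (induction n arbitrary: m)
  case 0
  then show ?case using assms by (simp add: hmom_0_0)
next
  case (Suc n)
  let ?D = "\<lambda>f. \<Sum>i\<le>n. (f i (n - i) :: real)"
  have refl: "(\<Sum>i\<le>k. f (k - i)) = (\<Sum>i\<le>k. f i)" for k and f :: "nat \<Rightarrow> real"
    by (rule sum.nat_diff_reindex[of f "Suc k", unfolded lessThan_Suc_atMost, simplified])
  define T where "T = (\<Sum>i\<le>Suc n. hmom s m i (Suc n - i))"
  define U where "U = (\<Sum>i\<le>Suc n. real i * hmom s m i (Suc n - i))"
  have "real (Suc n) * T = U
      + (\<Sum>i\<le>Suc n. real (Suc n - i) * hmom s m i (Suc n - i))"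
    unfolding T_def U_def sum_distrib_left sum.distrib[symmetric]
    by (intro sum.cong) (auto simp: of_nat_diff algebra_simps)
  \<comment> \<open>The weights \<open>i\<close> and \<open>n + 1 - i\<close> contribute equally by symmetry.\<close>
  also have "(\<Sum>i\<le>Suc n. real (Suc n - i) * hmom s m i (Suc n - i))
      = U"
    unfolding U_def by (subst refl[of "\<lambda>i. real i * hmom s m i (Suc n - i)", symmetric])
       (auto intro!: sum.cong simp: hmom_sym)
  finally have T: "real (Suc n) * T = 2 * U" by simp
  have "U = (\<Sum>i\<le>n. real (Suc i) * hmom s m (Suc i) (n - i))"
    unfolding U_def by (subst sum.atMost_Suc_shift) simp
  also have "\<dots> = (\<Sum>i\<le>n. real m / 2 * hmom s (m - 1) i (n - i))
      + ((\<Sum>i\<le>n. prev (hmom s m i) (n - i)) - (\<Sum>i\<le>n. prev (\<lambda>i'. hmom s m i' (n - i)) i)) / (4 * s)"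
    unfolding hmom_rec[OF assms] sum.distrib
    by (simp add: sum_subtractf sum_divide_distrib diff_divide_distrib)
  finally have U: "U = (\<Sum>i\<le>n. real m / 2 * hmom s (m - 1) i (n - i))
      + ((\<Sum>i\<le>n. prev (hmom s m i) (n - i)) - (\<Sum>i\<le>n. prev (\<lambda>i'. hmom s m i' (n - i)) i)) / (4 * s)" .
  \<comment> \<open>Both sums run over the antidiagonal \<open>n - 1\<close>, so the two lowering terms of the recurrence cancel.\<close>
  have shift: "(\<Sum>i\<le>n. prev (hmom s m i) (n - i)) = (\<Sum>i\<le>n. prev (\<lambda>i'. hmom s m i' (n - i)) i)"
  proof (cases n)
    case (Suc k)
    have "(\<Sum>i\<le>Suc k. prev (hmom s m i) (Suc k - i)) = (\<Sum>i\<le>k. hmom s m i (k - i))"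
      by (simp add: Suc_diff_le)
    moreover have "(\<Sum>i\<le>Suc k. prev (\<lambda>i'. hmom s m i' (Suc k - i)) i) = (\<Sum>i\<le>k. hmom s m i (k - i))"
      by (subst sum.atMost_Suc_shift) simp
    ultimately show ?thesis using Suc by simp
  qed simp
  have main: "(\<Sum>i\<le>n. real m / 2 * hmom s (m - 1) i (n - i)) = real m / 2 * (real (m - 1 choose n) * gmom s (m - 1 - n))"
    unfolding sum_distrib_left[symmetric] Suc.IH ..
  have "real (Suc n) * T = real m * real (m - 1 choose n) * gmom s (m - Suc n)"
    unfolding T U shift main by simp
  also have "real m * real (m - 1 choose n) = real (Suc n) * real (m choose Suc n)"
  proof (cases m)
    case (Suc k)
    have "Suc k * (k choose n) = Suc n * (Suc k choose Suc n)"
      unfolding Suc_times_binomial_eq by (rule mult.commute)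
    then show ?thesis
      unfolding Suc diff_Suc_1 of_nat_mult[symmetric] by (rule arg_cong)
  qed simp
  finally show ?case
    unfolding T_def by (simp del: sum.atMost_Suc of_nat_Suc)
qed

text \<open>
  The moments only grow if each polynomial is replaced by its leading term, since this turns the
  recurrence into the one with all signs positive.
\<close>

lemma abs_hmom_le_gmom:
  assumes "s > 0"
  shows "\<bar>hmom s m i j\<bar> \<le> gmom s (m + i + j) / ((2 * s) ^ (i + j) * fact i * fact j)"
proof -
  define B where "B m i j = gmom s (m + i + j) / ((2 * s) ^ (i + j) * fact i * fact j)" for m i j
  have B_rec: "real (Suc i) * B m (Suc i) j = real m / 2 * B (m - 1) i j
      + (prev (B m i) j + prev (\<lambda>i. B m i j) i) / (4 * s)" for m i j
  proof -
    define H where "H = gmom s (m + i + j - 1) / ((2 * s) ^ (i + j) * fact i * fact j)"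
    have 1: "real m / 2 * B (m - 1) i j = real m / 2 * H"
      by (cases m) (simp_all add: B_def H_def)
    have 2: "prev (B m i) j = 2 * s * real j * H"
      using assms by (cases j) (simp_all add: B_def H_def divide_simps)
    have 3: "prev (\<lambda>i. B m i j) i = 2 * s * real i * H"
      using assms by (cases i) (simp_all add: B_def H_def divide_simps)
    have 4: "real (Suc i) * B m (Suc i) j = real (m + i + j) / 2 * H"
      using assms by (simp add: B_def H_def gmom_Suc divide_simps del: of_nat_add)
    show ?thesis
      unfolding 1 2 3 4 using assms by (simp add: field_simps)
  qed
  have "\<bar>hmom s m i j\<bar> \<le> B m i j"
  proof (induction "i + j" arbitrary: m i j rule: less_induct)
    case less
    have step: "\<bar>hmom s m (Suc i) j\<bar> \<le> B m (Suc i) j"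
      if IH: "\<And>m i' j'. i' + j' < Suc i + j \<Longrightarrow> \<bar>hmom s m i' j'\<bar> \<le> B m i' j'" for m i j
    proof -
      have "\<bar>hmom s (m - 1) i j\<bar> \<le> B (m - 1) i j"
        by (rule IH) simp
      moreover have "\<bar>prev (hmom s m i) j\<bar> \<le> prev (B m i) j"
        using IH by (cases j) auto
      moreover have "\<bar>prev (\<lambda>i. hmom s m i j) i\<bar> \<le> prev (\<lambda>i. B m i j) i"
        using IH by (cases i) auto
      ultimately have "real m / 2 * \<bar>hmom s (m - 1) i j\<bar> +
          (\<bar>prev (hmom s m i) j\<bar> + \<bar>prev (\<lambda>i. hmom s m i j) i\<bar>) / (4 * s)
          \<le> real m / 2 * B (m - 1) i j + (prev (B m i) j + prev (\<lambda>i. B m i j) i) / (4 * s)"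
        using assms by (intro add_mono mult_left_mono divide_right_mono) auto
      moreover have "\<bar>real m / 2 * hmom s (m - 1) i j + (prev (hmom s m i) j - prev (\<lambda>i. hmom s m i j) i) / (4 * s)\<bar>
          \<le> real m / 2 * \<bar>hmom s (m - 1) i j\<bar> +
          (\<bar>prev (hmom s m i) j\<bar> + \<bar>prev (\<lambda>i. hmom s m i j) i\<bar>) / (4 * s)"
      proof -
        have "\<bar>(a - b) / (4 * s)\<bar> \<le> (\<bar>a\<bar> + \<bar>b\<bar>) / (4 * s)" for a b
          using assms by (simp add: abs_mult divide_right_mono abs_triangle_ineq4)
        then show ?thesis
          by (intro order_trans[OF abs_triangle_ineq] add_mono) (auto simp: abs_mult)
      qed
      ultimately have "\<bar>real (Suc i) * hmom s m (Suc i) j\<bar> \<le> real (Suc i) * B m (Suc i) j"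
        unfolding hmom_rec[OF assms] B_rec by (rule order_trans[rotated])
      then show ?thesis
        unfolding abs_mult by (simp del: of_nat_Suc)
    qed
    consider i' where "i = Suc i'" | j' where "i = 0" "j = Suc j'" | "i = 0" "j = 0"
      by (metis not0_implies_Suc)
    then show ?case
    proof cases
      case 1
      show ?thesis
        unfolding 1 by (rule step) (use less 1 in auto)
    next
      case 2
      have "\<bar>hmom s m (Suc j') 0\<bar> \<le> B m (Suc j') 0"
        using less 2 by (intro step) auto
      then show ?thesis
        using 2 hmom_sym[of s m 0 j] by (simp add: B_def mult_ac)
    next
      case 3
      then show ?thesis
        using gmom_nonneg[OF assms] by (simp add: hmom_0_0[OF assms] B_def)
    qed
  qed
  then show ?thesis by (simp add: B_def)
qed

text \<open>A multinomial coefficient is at most the corresponding power of three.\<close>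

lemma fact_add3_le: "fact (m + i + j) \<le> (3 ^ (m + i + j) * (fact m * fact i * fact j) :: real)"
proof -
  have fact_add: "fact (a + b) = (fact a * fact b * real ((a + b) choose a) :: real)" for a b
    using binomial_fact_lemma[of a "a + b"]
    by (metis (no_types) add_diff_cancel_left' le_add1 of_nat_fact of_nat_mult)
  have "real (m + (i + j) choose m) * 2 ^ (i + j) \<le> (\<Sum>k\<le>m + (i + j). real (m + (i + j) choose k) * 2 ^ (m + (i + j) - k))"
    by (rule order_trans[OF _ member_le_sum[of m]]) auto
  also have "\<dots> = 3 ^ (m + (i + j))"
    using binomial_ring[of "1::real" 2 "m + (i + j)"] by simp
  finally have *: "real (m + (i + j) choose m) * 2 ^ (i + j) \<le> 3 ^ (m + (i + j))" .
  have "real (i + j choose i) \<le> 2 ^ (i + j)"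
    using binomial_le_pow2[of "i + j" i] by (metis of_nat_le_iff of_nat_numeral of_nat_power)
  then have "real (m + (i + j) choose m) * real (i + j choose i) \<le> 3 ^ (m + (i + j))"
    by (intro order_trans[OF mult_left_mono *]) auto
  then have "(fact m * fact i * fact j :: real) * (real (m + (i + j) choose m) * real (i + j choose i))
      \<le> (fact m * fact i * fact j) * 3 ^ (m + (i + j))"
    by (rule mult_left_mono) simp
  moreover have "fact (m + i + j) = (fact m * fact i * fact j :: real) * (real (m + (i + j) choose m) * real (i + j choose i))"
    using fact_add[of m "i + j"] fact_add[of i j] by (simp add: add.assoc mult_ac)
  ultimately show ?thesis by (simp add: mult_ac add.assoc)
qed

text \<open>
  For \<open>3 s \<le> 1\<close> the bound is geometric in \<open>i + j\<close> once the monomials \<open>x\<^sup>i\<close> are normalised to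
  \<open>x\<^sup>i / \<surd>(i!)\<close>, and its dependence on \<open>m\<close> is the weight of \<open>x\<^sup>m\<close> in the norm.
\<close>

lemma abs_hmom_le:
  assumes "s > 0" and "3 * s \<le> 1"
  shows "\<bar>hmom s m i j\<bar> * sqrt (fact i * fact j) \<le> sqrt (fact m) * sqrt (3 / (4 * s)) ^ (i + j)"
proof -
  define D :: real where "D = fact i * fact j"
  have D: "D > 0" by (simp add: D_def)
  have sqp: "sqrt (x ^ n) = sqrt x ^ n" for x n by (rule real_sqrt_power)
  have "\<bar>hmom s m i j\<bar> * sqrt D \<le> gmom s (m + i + j) / ((2 * s) ^ (i + j) * D) * sqrt D"
    using abs_hmom_le_gmom[OF assms(1), of m i j] D
    by (intro mult_right_mono) (auto simp: D_def mult_ac)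
  also have "\<dots> = gmom s (m + i + j) / ((2 * s) ^ (i + j) * sqrt D)"
  proof -
    define r where "r = sqrt D"
    have "r > 0" "D = r * r" using D by (simp_all add: r_def)
    then show ?thesis unfolding r_def[symmetric] by simp
  qed
  also have "\<dots> \<le> (sqrt s ^ (m + i + j) * sqrt (fact (m + i + j))) / ((2 * s) ^ (i + j) * sqrt D)"
    using gmom_le[OF assms(1), of "m + i + j"] assms(1) D by (intro divide_right_mono) auto
  also have "\<dots> \<le> (sqrt s ^ (m + i + j) * sqrt (3 ^ (m + i + j) * (fact m * D))) / ((2 * s) ^ (i + j) * sqrt D)"
    using fact_add3_le[of m i j] assms(1) D
    by (intro divide_right_mono mult_left_mono real_sqrt_le_mono) (auto simp: D_def mult_ac)
  also have "\<dots> = sqrt (fact m) * sqrt (3 * s) ^ m * (sqrt (3 * s) / (2 * s)) ^ (i + j)"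
  proof -
    define r where "r = sqrt D"
    have "r > 0" using D by (simp add: r_def)
    then show ?thesis
      using assms(1) unfolding real_sqrt_mult sqp r_def[symmetric] power_add
      by (simp add: power_mult_distrib power_divide mult_ac)
  qed
  also have "sqrt (3 * s) / (2 * s) = sqrt (3 / (4 * s))"
  proof -
    have "(sqrt (3 * s) / (2 * s))\<^sup>2 = 3 / (4 * s)"
      using assms(1) by (simp add: power_divide power2_eq_square)
    then show ?thesis
      using assms(1) real_sqrt_unique[of "sqrt (3 * s) / (2 * s)" "3 / (4 * s)"] by simp
  qed
  also have "sqrt (fact m) * sqrt (3 * s) ^ m * sqrt (3 / (4 * s)) ^ (i + j)
      \<le> sqrt (fact m) * 1 * sqrt (3 / (4 * s)) ^ (i + j)"
    using assms by (intro mult_right_mono mult_left_mono power_le_one) auto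
  finally show ?thesis by (simp add: D_def)
qed

text \<open>The norm of the heat flow of \<open>x\<^sup>n\<close>, relative to the norm of \<open>x\<^sup>n\<close>.\<close>

lemma heat_flow_norm_le:
  assumes "s > 0"
  shows "(\<Sum>k\<le>n. real (n choose k) * gmom s (n - k) * sqrt (fact k)) \<le> sqrt (fact n) * exp (s * real n / 2)"
proof -
  define h where "h i = real (n choose i) * gmom s i * sqrt (fact (n - i))" for i
  have h_le: "h (2 * l) \<le> sqrt (fact n) * ((s * real n / 2) ^ l /\<^sub>R fact l)" if "2 * l \<le> n" for l
  proof -
    define k where "k = n - 2 * l"
    have n: "n = 2 * l + k" using that by (simp add: k_def)
    have "(fact n :: real) \<le> real (n ^ (2 * l)) * fact k"
    proof -
      have "fact n div fact (n - 2 * l) \<le> n ^ (2 * l)" by (rule fact_div_fact_le_pow[OF that])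
      moreover have "fact k dvd (fact n :: nat)" using n by (simp add: fact_dvd)
      ultimately have "fact n \<le> n ^ (2 * l) * fact k"
        using mult_le_mono1[of "fact n div fact k" "n ^ (2 * l)" "fact k :: nat"]
          dvd_div_mult_self[of "fact k :: nat" "fact n"]
        unfolding k_def[symmetric] by simp
      then have "real (fact n) \<le> real (n ^ (2 * l) * fact k)" by (rule of_nat_mono)
      then show ?thesis by simp
    qed
    then have "sqrt (fact n) \<le> sqrt ((real n ^ l)\<^sup>2 * fact k)"
      unfolding real_sqrt_le_iff of_nat_power power_even_eq .
    then have *: "sqrt (fact n) \<le> real n ^ l * sqrt (fact k)"
      by (simp add: real_sqrt_mult)
    have "h (2 * l) = fact n / (fact (2 * l) * fact k) * ((s / 2) ^ l * fact (2 * l) / fact l) * sqrt (fact k)"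
      using binomial_fact[OF that, where ?'a = real] by (simp add: h_def gmom_def k_def)
    also have "\<dots> = (fact k * (sqrt (fact k))) * (fact n * ((s / 2) ^ l / fact l)) / (fact k * fact k)"
      by (simp add: mult_ac)
    also have "\<dots> = fact n / sqrt (fact k) * ((s / 2) ^ l / fact l)"
    proof -
      define r where "r = sqrt (fact k)"
      have "r > 0" "fact k = r * r" by (simp_all add: r_def)
      then show ?thesis unfolding r_def[symmetric] by simp
    qed
    also have "\<dots> \<le> (sqrt (fact n) * real n ^ l) * ((s / 2) ^ l / fact l)"
    proof (rule mult_right_mono)
      have "sqrt (fact n) * sqrt (fact n) \<le> sqrt (fact n) * (real n ^ l * sqrt (fact k))"
        using * by (intro mult_left_mono) auto
      then show "fact n / sqrt (fact k) \<le> sqrt (fact n) * real n ^ l"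
        by (simp add: divide_le_eq mult.assoc)
    qed (use assms in auto)
    also have "\<dots> = sqrt (fact n) * ((s * real n / 2) ^ l /\<^sub>R fact l)"
    proof -
      have "(s * real n / 2) ^ l = (s / 2) ^ l * real n ^ l"
        by (simp add: power_mult_distrib power_divide)
      then show ?thesis
        by (simp only: real_scaleR_def divide_inverse mult_ac)
    qed
    finally show ?thesis .
  qed
  have "(\<Sum>k\<le>n. real (n choose k) * gmom s (n - k) * sqrt (fact k)) = (\<Sum>k\<le>n. h (n - k))"
    by (intro sum.cong) (auto simp: h_def binomial_symmetric[symmetric])
  also have "\<dots> = (\<Sum>i\<le>n. h i)"
    by (rule sum.nat_diff_reindex[of h "Suc n", unfolded lessThan_Suc_atMost, simplified])
  also have "\<dots> = (\<Sum>i\<in>(*) 2 ` {..n div 2}. h i)"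
  proof (rule sum.mono_neutral_right)
    show "\<forall>i\<in>{..n} - (*) 2 ` {..n div 2}. h i = 0"
      by (auto simp: h_def gmom_def image_iff elim!: evenE)
  qed auto
  also have "\<dots> = (\<Sum>l\<le>n div 2. h (2 * l))"
    by (subst sum.reindex) (auto simp: inj_on_def)
  also have "\<dots> \<le> (\<Sum>l\<le>n div 2. sqrt (fact n) * ((s * real n / 2) ^ l /\<^sub>R fact l))"
    by (intro sum_mono h_le) auto
  also have "\<dots> \<le> sqrt (fact n) * exp (s * real n / 2)"
    unfolding sum_distrib_left[symmetric] exp_def
    using assms by (intro mult_left_mono sum_le_suminf summable_exp_generic) auto
  finally show ?thesis .
qed

section \<open>Sums of squares\<close>

lemma is_sos_0: "is_sos 0"
  unfolding is_sos_def by (rule exI[of _ "[]"]) simp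

lemma is_sos_square: "is_sos (q ^ 2)"
  unfolding is_sos_def by (rule exI[of _ "[q]"]) simp

lemma is_sos_add: "is_sos p \<Longrightarrow> is_sos q \<Longrightarrow> is_sos (p + q)"
  unfolding is_sos_def by (metis map_append sum_list_append)

lemma is_sos_sum: "(\<And>i. i \<in> I \<Longrightarrow> is_sos (f i)) \<Longrightarrow> is_sos (\<Sum>i\<in>I. f i)"
  by (induction I rule: infinite_finite_induct) (auto simp: is_sos_0 is_sos_add)

lemma is_sos_mult_square:
  assumes "is_sos p"
  shows "is_sos (q ^ 2 * p)"
proof -
  from assms obtain qs where p: "p = (\<Sum>r\<leftarrow>qs. r ^ 2)"
    unfolding is_sos_def by blast
  have "q ^ 2 * p = (\<Sum>r\<leftarrow>map ((*) q) qs. r ^ 2)"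
    unfolding p by (induction qs) (simp_all add: distrib_left power_mult_distrib)
  then show ?thesis unfolding is_sos_def by blast
qed

lemma pconst_add: "pconst (a + b) = pconst a + pconst b"
  by (simp add: pconst_def single_add)

lemma pconst_diff: "pconst (a - b) = pconst a - pconst b"
  by (simp add: pconst_def single_diff)

lemma pconst_mult: "pconst (a * b) = pconst a * pconst b"
  by (simp add: pconst_def mult_single)

lemma pconst_1 [simp]: "pconst 1 = 1"
  by (simp add: pconst_def)

lemma pconst_0 [simp]: "pconst 0 = 0"
  by (simp add: pconst_def)

lemma pconst_uminus: "pconst (- a) = - pconst a"
  by (simp add: pconst_def single_uminus)

lemma pconst_power: "pconst (a ^ n) = pconst a ^ n"
  by (induction n) (simp_all add: pconst_mult)

lemma pconst_sum: "pconst (\<Sum>i\<in>I. f i) = (\<Sum>i\<in>I. pconst (f i))"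
  by (induction I rule: infinite_finite_induct) (simp_all add: pconst_add)

lemma is_sos_pconst_mult:
  fixes p :: "'d mpoly"
  assumes "c \<ge> 0" and "is_sos p"
  shows "is_sos (pconst c * p)"
proof -
  have "(pconst c :: 'd mpoly) = pconst (sqrt c) ^ 2"
    using assms(1) by (simp flip: pconst_power)
  then show ?thesis using is_sos_mult_square[OF assms(2)] by simp
qed

text \<open>
  A positive semidefinite quadratic form is a sum of squares of linear forms, by completing the
  square in one variable after the other.
\<close>

lemma is_sos_quadratic_form:
  fixes X :: "'a \<Rightarrow> 'd mpoly" and C :: "'a \<Rightarrow> 'a \<Rightarrow> real"
  assumes "finite A"
    and sym: "\<And>a b. a \<in> A \<Longrightarrow> b \<in> A \<Longrightarrow> C a b = C b a"
    and psd: "\<And>v. (\<Sum>a\<in>A. \<Sum>b\<in>A. C a b * v a * v b) \<ge> 0"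
  shows "is_sos (\<Sum>a\<in>A. \<Sum>b\<in>A. pconst (C a b) * X a * X b)"
  using assms
proof (induction A arbitrary: C rule: finite_induct)
  case empty
  show ?case by (simp add: is_sos_0)
next
  case (insert a A)
  have sym: "C b c = C c b" if "b \<in> insert a A" "c \<in> insert a A" for b c
    using insert.prems(1) that by blast
  have split: "(\<Sum>b\<in>insert a A. \<Sum>c\<in>insert a A. F b c) =
      F a a + (\<Sum>b\<in>A. F a b) + (\<Sum>b\<in>A. F b a) + (\<Sum>b\<in>A. \<Sum>c\<in>A. F b c)"
    for F :: "'a \<Rightarrow> 'a \<Rightarrow> 'b::comm_monoid_add"
    using insert.hyps by (simp add: sum.distrib ac_simps)
  have psd: "C a a * x\<^sup>2 + 2 * x * (\<Sum>b\<in>A. C a b * v b) + (\<Sum>b\<in>A. \<Sum>c\<in>A. C b c * v b * v c) \<ge> 0" for x v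
  proof -
    have "(\<Sum>b\<in>A. C b a * v b * x) = (\<Sum>b\<in>A. C a b * x * v b)"
      using sym by (intro sum.cong) auto
    moreover have "(\<Sum>b\<in>A. C a b * x * v b) = x * (\<Sum>b\<in>A. C a b * v b)"
      by (simp add: sum_distrib_left mult_ac)
    moreover have "(\<Sum>b\<in>insert a A. \<Sum>c\<in>insert a A. C b c * (v(a := x)) b * (v(a := x)) c) =
        C a a * x * x + (\<Sum>b\<in>A. C a b * x * v b) + (\<Sum>b\<in>A. C b a * v b * x)
        + (\<Sum>b\<in>A. \<Sum>c\<in>A. C b c * v b * v c)"
      unfolding split using insert.hyps(2)
      by (intro arg_cong2[where f = "(+)"] sum.cong) auto
    ultimately show ?thesis
      using insert.prems(2)[of "v(a := x)"] by (simp add: power2_eq_square)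
  qed
  show ?case
  proof (cases "C a a = 0")
    case True
    \<comment> \<open>Otherwise the form would be affine and nonconstant in the variable \<open>a\<close>, hence unbounded below.\<close>
    have zero: "C a b = 0" if b: "b \<in> A" for b
    proof (rule ccontr)
      assume nz: "C a b \<noteq> 0"
      have "2 * x * C a b + C b b \<ge> 0" for x
        using psd[of x "\<lambda>c. if c = b then 1 else 0"] b insert.hyps True
        by (simp add: if_distrib[of "(*) _"] if_distribR cong: if_cong)
      moreover have "2 * (- (\<bar>C b b\<bar> + 1) / (2 * C a b)) * C a b = - (\<bar>C b b\<bar> + 1)"
        using nz by simp
      ultimately have "- (\<bar>C b b\<bar> + 1) + C b b \<ge> 0" by metis
      then show False by simp
    qed
    have "is_sos (\<Sum>b\<in>A. \<Sum>c\<in>A. pconst (C b c) * X b * X c)"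
      using psd[of 0] sym by (intro insert.IH) auto
    moreover have "C b a = 0" if "b \<in> A" for b
      using zero[OF that] sym[of b a] that by simp
    ultimately show ?thesis
      unfolding split using zero True by simp
  next
    case False
    have pos: "C a a > 0"
      using psd[of 1 "\<lambda>_. 0"] False by simp
    \<comment> \<open>The Schur complement of the diagonal entry at \<open>a\<close>.\<close>
    define C' where "C' b c = C b c - C a b * C a c / C a a" for b c
    have "(\<Sum>b\<in>A. \<Sum>c\<in>A. C' b c * v b * v c) \<ge> 0" for v
    proof -
      define S where "S = (\<Sum>b\<in>A. C a b * v b)"
      have "(\<Sum>b\<in>A. \<Sum>c\<in>A. C' b c * v b * v c) = (\<Sum>b\<in>A. \<Sum>c\<in>A. C b c * v b * v c) - S * S / C a a"
        unfolding C'_def S_def sum_product sum_divide_distrib sum_subtractf[symmetric]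
        by (intro sum.cong refl) (simp add: algebra_simps)
      moreover have "C a a * (- S / C a a)\<^sup>2 + 2 * (- S / C a a) * S = - (S * S / C a a)"
        using pos by (simp add: power2_eq_square)
      ultimately show ?thesis
        using psd[of "- S / C a a" v] by (simp add: S_def)
    qed
    then have IH: "is_sos (\<Sum>b\<in>A. \<Sum>c\<in>A. pconst (C' b c) * X b * X c)"
      using sym by (intro insert.IH) (auto simp: C'_def)
    have C'_eq: "C' b c = C b c - 1 / C a a * (C a b * C a c)" for b c
      by (simp add: C'_def)
    define L where "L = (\<Sum>b\<in>A. pconst (C a b) * X b)"
    have inv: "pconst (1 / C a a) * pconst (C a a) = (1 :: 'd mpoly)"
      using pos by (simp flip: pconst_mult)
    have "(\<Sum>b\<in>A. \<Sum>c\<in>A. pconst (C' b c) * X b * X c) =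
        (\<Sum>b\<in>A. \<Sum>c\<in>A. pconst (C b c) * X b * X c) - pconst (1 / C a a) * (L * L)"
    proof -
      have "(\<Sum>b\<in>A. \<Sum>c\<in>A. pconst (C' b c) * X b * X c) =
          (\<Sum>b\<in>A. \<Sum>c\<in>A. pconst (C b c) * X b * X c
            - pconst (1 / C a a) * ((pconst (C a b) * X b) * (pconst (C a c) * X c)))"
        unfolding C'_eq pconst_diff pconst_mult by (intro sum.cong refl) (simp add: algebra_simps)
      then show ?thesis
        unfolding L_def sum_product by (simp only: sum_subtractf sum_distrib_left)
    qed
    moreover have "pconst (1 / C a a) * (pconst (C a a) * X a + L) ^ 2 =
        (pconst (1 / C a a) * pconst (C a a)) * (pconst (C a a) * X a * X a + 2 * X a * L) + pconst (1 / C a a) * (L * L)"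
      by (simp add: power2_eq_square algebra_simps)
    moreover have "(\<Sum>b\<in>A. pconst (C a b) * X a * X b) = X a * L"
      "(\<Sum>b\<in>A. pconst (C b a) * X b * X a) = X a * L"
      unfolding L_def sum_distrib_left using sym
      by (auto intro!: sum.cong simp: mult_ac)
    ultimately have "(\<Sum>b\<in>insert a A. \<Sum>c\<in>insert a A. pconst (C b c) * X b * X c) =
        pconst (1 / C a a) * (pconst (C a a) * X a + L) ^ 2 + (\<Sum>b\<in>A. \<Sum>c\<in>A. pconst (C' b c) * X b * X c)"
      unfolding split inv by (simp add: algebra_simps)
    then show ?thesis
      using pos IH by (simp add: is_sos_add is_sos_pconst_mult is_sos_square)
  qed
qed

section \<open>Monomials\<close>

text \<open>The monomial \<open>x\<^sup>\<alpha>\<close> and its total degree.\<close>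

definition mon :: "('d \<Rightarrow>\<^sub>0 nat) \<Rightarrow> 'd mpoly"
  where "mon \<alpha> = Poly_Mapping.single \<alpha> 1"

definition mdeg :: "('d::finite \<Rightarrow>\<^sub>0 nat) \<Rightarrow> nat"
  where "mdeg \<alpha> = (\<Sum>j\<in>UNIV. Poly_Mapping.lookup \<alpha> j)"

lemma mon_add: "mon (\<alpha> + \<beta>) = mon \<alpha> * mon \<beta>"
  by (simp add: mon_def mult_single)

lemma mon_0 [simp]: "mon 0 = 1"
  by (simp add: mon_def)

lemma mdeg_add: "mdeg (\<alpha> + \<beta>) = mdeg \<alpha> + mdeg \<beta>"
  by (simp add: mdeg_def lookup_add sum.distrib)

lemma mdeg_le_pdegree: "\<alpha> \<in> Poly_Mapping.keys p \<Longrightarrow> mdeg \<alpha> \<le> pdegree p"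
  unfolding pdegree_def mdeg_def by (intro Max_ge) auto

lemma mpoly_eq_sum_mon: "p = (\<Sum>\<alpha>\<in>Poly_Mapping.keys p. pconst (Poly_Mapping.lookup p \<alpha>) * mon \<alpha>)"
proof (rule poly_mapping_eqI)
  fix \<beta>
  have "(\<Sum>\<alpha>\<in>Poly_Mapping.keys p. Poly_Mapping.lookup p \<alpha> when \<alpha> = \<beta>) = Poly_Mapping.lookup p \<beta>"
    by (cases "\<beta> \<in> Poly_Mapping.keys p") (auto simp: when_def in_keys_iff)
  then show "Poly_Mapping.lookup p \<beta> =
      Poly_Mapping.lookup (\<Sum>\<alpha>\<in>Poly_Mapping.keys p. pconst (Poly_Mapping.lookup p \<alpha>) * mon \<alpha>) \<beta>"
    by (simp add: lookup_sum pconst_def mon_def mult_single lookup_single)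
qed

lemma exponent_split:
  assumes "mdeg \<gamma> \<le> 2 * N"
  obtains \<alpha> \<beta> :: "'d::finite \<Rightarrow>\<^sub>0 nat" where "\<gamma> = \<alpha> + \<beta>" "mdeg \<alpha> \<le> N" "mdeg \<beta> \<le> N"
proof -
  have "\<exists>\<alpha> \<beta>. \<gamma> = \<alpha> + \<beta> \<and> mdeg \<alpha> = k" if "k \<le> mdeg \<gamma>" for k
    using that
  proof (induction k)
    case 0
    then show ?case by (intro exI[of _ 0] exI[of _ \<gamma>]) (simp add: mdeg_def)
  next
    case (Suc k)
    then obtain \<alpha> \<beta> where *: "\<gamma> = \<alpha> + \<beta>" "mdeg \<alpha> = k" by auto
    then have "mdeg \<beta> \<noteq> 0" using Suc.prems by (auto simp: mdeg_add)
    then obtain j where j: "Poly_Mapping.lookup \<beta> j \<noteq> 0"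
      unfolding mdeg_def by (meson sum.neutral)
    define e where "e = Poly_Mapping.single j (1::nat)"
    define \<delta> where "\<delta> = \<beta> - e"
    have "\<beta> = e + \<delta>"
      unfolding \<delta>_def using j by (intro poly_mapping_eqI) (auto simp: e_def lookup_add lookup_minus lookup_single when_def)
    moreover have "mdeg e = 1"
      by (simp add: mdeg_def e_def lookup_single when_def)
    ultimately show ?case
      using * by (intro exI[of _ "\<alpha> + e"] exI[of _ \<delta>]) (simp add: mdeg_add add.assoc)
  qed
  from this[of "min N (mdeg \<gamma>)"] obtain \<alpha> \<beta> where "\<gamma> = \<alpha> + \<beta>" "mdeg \<alpha> = min N (mdeg \<gamma>)"
    by auto
  moreover from this have "mdeg \<beta> \<le> N"
    using assms by (auto simp: mdeg_add)
  ultimately show ?thesis using that by auto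
qed

lemma mfact_mult_le: "mfact \<alpha> * mfact \<beta> \<le> mfact (\<alpha> + \<beta>)"
proof -
  have "fact a * fact b \<le> (fact (a + b) :: real)" for a b
    by (metis fact_fact_dvd_fact dvd_imp_le fact_gt_zero of_nat_fact of_nat_le_iff of_nat_mult)
  then show ?thesis
    unfolding mfact_def lookup_add prod.distrib[symmetric] by (intro prod_mono) auto
qed

section \<open>The penalty polynomial\<close>

text \<open>The squared Euclidean norm of the vector of variables.\<close>

definition sqn :: "('d::finite) mpoly"
  where "sqn = (\<Sum>j\<in>UNIV. pvar j ^ 2)"

text \<open>The perturbing sum \<open>\<Sum>\<^bsub>n \<le> N\<^esub> \<parallel>x\<parallel>\<^bsup>2n\<^esup> / (n!)\<^sup>t\<close>.\<close>

definition penalty :: "nat \<Rightarrow> real \<Rightarrow> ('d::finite) mpoly"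
  where "penalty N t = (\<Sum>n = 0..N. pconst (1 / (fact n powr t)) * sqn ^ n)"

lemma is_sos_sqn_power: "is_sos (sqn ^ n)"
proof (induction n)
  case 0
  then show ?case using is_sos_square[of 1] by simp
next
  case (Suc n)
  then show ?case
    by (auto simp: sqn_def sum_distrib_right intro!: is_sos_sum is_sos_mult_square)
qed

text \<open>
  The subtracted term is one of the terms in the multinomial expansion of \<open>sqn ^ n\<close>, all of which
  are nonnegative multiples of squares.
\<close>

lemma is_sos_sqn_power_diff:
  assumes "mdeg \<alpha> = n"
  shows "is_sos (sqn ^ n - pconst (fact n / mfact \<alpha>) * mon \<alpha> ^ 2)"
  using assms
proof (induction n arbitrary: \<alpha>)
  case 0
  then have "\<alpha> = 0" by (intro poly_mapping_eqI) (simp add: mdeg_def)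
  then show ?case by (simp add: mfact_def is_sos_0)
next
  case (Suc n)
  define e where "e j = Poly_Mapping.single j (1::nat)" for j :: 'a
  have mon_e: "mon (e j) = pvar j" for j
    by (simp add: mon_def e_def pvar_def)
  let ?c = "\<lambda>j. fact n * real (Poly_Mapping.lookup \<alpha> j) / mfact \<alpha>"
  have "is_sos (pvar j ^ 2 * sqn ^ n - pconst (?c j) * mon \<alpha> ^ 2)" for j
  proof (cases "Poly_Mapping.lookup \<alpha> j = 0")
    case True
    show ?thesis using True by (simp add: is_sos_mult_square is_sos_sqn_power)
  next
    case False
    define \<beta> where "\<beta> = \<alpha> - e j"
    have \<alpha>: "\<alpha> = \<beta> + e j"
      using False by (intro poly_mapping_eqI)
        (auto simp: \<beta>_def e_def lookup_add lookup_minus lookup_single when_def)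
    have "mdeg (e j) = 1"
      by (simp add: mdeg_def e_def lookup_single when_def)
    then have "mdeg \<beta> = n"
      using Suc.prems \<alpha> by (simp add: mdeg_add)
    moreover have "mfact \<alpha> = real (Poly_Mapping.lookup \<alpha> j) * mfact \<beta>"
    proof -
      have "mfact \<gamma> = fact (Poly_Mapping.lookup \<gamma> j) * (\<Prod>i\<in>UNIV - {j}. fact (Poly_Mapping.lookup \<gamma> i))" for \<gamma>
        unfolding mfact_def by (rule prod.remove) auto
      moreover have "(\<Prod>i\<in>UNIV - {j}. fact (Poly_Mapping.lookup \<alpha> i)) = (\<Prod>i\<in>UNIV - {j}. fact (Poly_Mapping.lookup \<beta> i) :: real)"
        by (intro prod.cong) (auto simp: \<beta>_def e_def lookup_minus lookup_single)
      moreover have "fact (Poly_Mapping.lookup \<alpha> j) = (real (Poly_Mapping.lookup \<alpha> j) * fact (Poly_Mapping.lookup \<beta> j) :: real)"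
        using False by (simp add: \<beta>_def e_def lookup_minus fact_reduce)
      ultimately show ?thesis by simp
    qed
    ultimately have "?c j = fact n / mfact \<beta>"
      using False by simp
    moreover have "is_sos (pvar j ^ 2 * (sqn ^ n - pconst (fact n / mfact \<beta>) * mon \<beta> ^ 2))"
      using Suc.IH[OF \<open>mdeg \<beta> = n\<close>] by (rule is_sos_mult_square)
    moreover have "mon \<alpha> = pvar j * mon \<beta>"
      unfolding \<alpha> mon_add mon_e by simp
    ultimately show ?thesis
      by (simp add: algebra_simps power_mult_distrib)
  qed
  then have "is_sos (\<Sum>j\<in>UNIV. pvar j ^ 2 * sqn ^ n - pconst (?c j) * mon \<alpha> ^ 2)"
    by (intro is_sos_sum)
  moreover have "(\<Sum>j\<in>UNIV. ?c j) = fact (Suc n) / mfact \<alpha>"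
    using Suc.prems unfolding mdeg_def
    by (simp add: sum_divide_distrib[symmetric] sum_distrib_left[symmetric] of_nat_sum[symmetric] del: of_nat_sum)
  ultimately show ?case
    by (simp add: sum_subtractf sum_distrib_right[symmetric] pconst_sum[symmetric] sqn_def)
qed

text \<open>The weight of \<open>x\<^bsup>2\<alpha>\<^esup> / \<alpha>!\<close> in the penalty polynomial.\<close>

definition wgt :: "real \<Rightarrow> ('d::finite \<Rightarrow>\<^sub>0 nat) \<Rightarrow> real"
  where "wgt t \<alpha> = fact (mdeg \<alpha>) powr (1 - t)"

lemma is_sos_penalty_diff:
  assumes "mdeg \<alpha> \<le> N"
  shows "is_sos (penalty N t - pconst (wgt t \<alpha> / mfact \<alpha>) * mon \<alpha> ^ 2)"
proof -
  let ?n = "mdeg \<alpha>"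
  let ?f = "\<lambda>n. pconst (1 / (fact n powr t)) * sqn ^ n :: 'a mpoly"
  let ?R = "\<Sum>n\<in>{0..N} - {?n}. ?f n"
  have pen: "penalty N t = ?f ?n + ?R"
    unfolding penalty_def using assms by (intro sum.remove) auto
  have w: "wgt t \<alpha> / mfact \<alpha> = 1 / (fact ?n powr t) * (fact ?n / mfact \<alpha>)"
    by (simp add: wgt_def powr_diff)
  have "penalty N t - pconst (wgt t \<alpha> / mfact \<alpha>) * mon \<alpha> ^ 2 =
      pconst (1 / (fact ?n powr t)) * (sqn ^ ?n - pconst (fact ?n / mfact \<alpha>) * mon \<alpha> ^ 2) + ?R"
    unfolding pen w pconst_mult by (simp only: right_diff_distrib mult.assoc) simp
  then show ?thesis
    by (auto intro!: is_sos_add is_sos_sum is_sos_pconst_mult is_sos_sqn_power is_sos_sqn_power_diff)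
qed

text \<open>
  Any product of two monomials of degree at most \<open>N\<close> is dominated by the penalty polynomial, by
  the inequality of arithmetic and geometric means.
\<close>

lemma is_sos_mon_add_penalty:
  assumes "mdeg \<alpha> \<le> N" and "mdeg \<beta> \<le> N"
    and le: "\<bar>c\<bar> * sqrt (mfact \<alpha> * mfact \<beta>) \<le> K * sqrt (wgt t \<alpha> * wgt t \<beta>)"
  shows "is_sos (pconst c * mon (\<alpha> + \<beta>) + pconst K * penalty N t)"
proof -
  define u where "u = sqrt (wgt t \<alpha> / mfact \<alpha>)"
  define v where "v = sqrt (wgt t \<beta> / mfact \<beta>)"
  have wpos: "wgt t \<gamma> > 0" for \<gamma> :: "'a \<Rightarrow>\<^sub>0 nat" by (simp add: wgt_def)
  have u: "u > 0" "u ^ 2 = wgt t \<alpha> / mfact \<alpha>" and v: "v > 0" "v ^ 2 = wgt t \<beta> / mfact \<beta>"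
    using divide_pos_pos[OF wpos mfact_pos] less_imp_le[OF divide_pos_pos[OF wpos mfact_pos]]
    by (simp_all add: u_def v_def)
  define k where "k = c / (u * v)"
  have "\<bar>c\<bar> \<le> K * (u * v)"
    using le mfact_pos[of \<alpha>] mfact_pos[of \<beta>]
    by (simp add: u_def v_def real_sqrt_mult real_sqrt_divide field_simps)
  then have K: "\<bar>k\<bar> \<le> K"
    using u v by (simp add: k_def abs_mult divide_le_eq)
  define U where "U = pconst u * mon \<alpha>"
  define V where "V = pconst v * mon \<beta>"
  define P where "P = (penalty N t :: 'a mpoly)"
  have U: "is_sos (P - U ^ 2)" and V: "is_sos (P - V ^ 2)"
    using is_sos_penalty_diff[OF assms(1), of t] is_sos_penalty_diff[OF assms(2), of t]
    unfolding U_def V_def P_def by (simp_all add: power_mult_distrib u v flip: pconst_power)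
  have 1: "pconst c * mon (\<alpha> + \<beta>) = pconst k * (U * V)"
  proof -
    have "c = k * (u * v)" using u v by (simp add: k_def)
    then show ?thesis by (simp only: mon_add pconst_mult U_def V_def mult_ac)
  qed
  define h where "h = K / 2"
  have KP: "pconst K = (pconst h + pconst h :: 'a mpoly)"
    by (simp add: h_def flip: pconst_add)
  define a where "a = \<bar>k\<bar> / 2"
  define r where "r = sgn k"
  have k: "k = a * r + a * r"
    by (simp add: a_def r_def sgn_if)
  have r: "pconst r * pconst r = (1 :: 'a mpoly) \<or> a = 0"
    unfolding a_def r_def by (cases "k = 0") (simp_all flip: pconst_mult)
  \<comment> \<open>Here \<open>a\<close> is half the absolute value of \<open>k\<close>, and \<open>r\<close> its sign: the cross term of the first square is \<open>k U V\<close>.\<close>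
  have "is_sos (pconst a * (U + pconst r * V) ^ 2 + pconst (h - a) * (U ^ 2 + V ^ 2)
      + (pconst h * (P - U ^ 2) + pconst h * (P - V ^ 2)))"
    using K U V by (intro is_sos_add is_sos_pconst_mult is_sos_square) (auto simp: a_def h_def)
  also have "pconst a * (U + pconst r * V) ^ 2 + pconst (h - a) * (U ^ 2 + V ^ 2)
      + (pconst h * (P - U ^ 2) + pconst h * (P - V ^ 2)) = pconst k * (U * V) + pconst K * P"
  proof (cases "a = 0")
    case True
    then show ?thesis unfolding KP k by (simp add: algebra_simps)
  next
    case False
    have "pconst a * (U + pconst r * V) ^ 2 = pconst a * U ^ 2 + (pconst a * pconst r + pconst a * pconst r) * (U * V)
        + pconst a * (pconst r * pconst r) * V ^ 2"
      by (simp add: power2_eq_square algebra_simps)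
    also have "\<dots> = pconst a * U ^ 2 + pconst k * (U * V) + pconst a * V ^ 2"
      unfolding k pconst_add pconst_mult using r False by simp
    finally show ?thesis
      unfolding KP pconst_diff by (simp add: algebra_simps)
  qed
  finally show ?thesis unfolding 1 P_def .
qed

section \<open>Sums over exponent vectors\<close>

lemma bij_betw_lookup_box:
  "bij_betw Poly_Mapping.lookup {\<alpha> :: 'd::finite \<Rightarrow>\<^sub>0 nat. \<forall>j. Poly_Mapping.lookup \<alpha> j \<le> m j} (PiE UNIV (\<lambda>j. {..m j}))"
  by (rule bij_betwI[where g = Abs_poly_mapping]) auto

lemma finite_box: "finite {\<alpha> :: 'd::finite \<Rightarrow>\<^sub>0 nat. \<forall>j. Poly_Mapping.lookup \<alpha> j \<le> m j}"
  using bij_betw_finite[OF bij_betw_lookup_box] by (simp add: finite_PiE)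

lemma sum_box_prod:
  fixes f :: "'d::finite \<Rightarrow> nat \<Rightarrow> real"
  shows "(\<Sum>\<alpha> | \<forall>j. Poly_Mapping.lookup \<alpha> j \<le> m j. \<Prod>j\<in>UNIV. f j (Poly_Mapping.lookup \<alpha> j)) =
    (\<Prod>j\<in>UNIV. \<Sum>k\<le>m j. f j k)"
proof -
  have "(\<Prod>j\<in>UNIV. \<Sum>k\<le>m j. f j k) = (\<Sum>g\<in>PiE UNIV (\<lambda>j. {..m j}). \<Prod>j\<in>UNIV. f j (g j))"
    by (rule prod_sum_PiE) auto
  also have "\<dots> = (\<Sum>\<alpha> | \<forall>j. Poly_Mapping.lookup \<alpha> j \<le> m j. \<Prod>j\<in>UNIV. f j (Poly_Mapping.lookup \<alpha> j))"
    by (rule sum.reindex_bij_betw[OF bij_betw_lookup_box, symmetric])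
  finally show ?thesis ..
qed

text \<open>The exponents of total degree at most \<open>N\<close>.\<close>

definition expos :: "nat \<Rightarrow> ('d::finite \<Rightarrow>\<^sub>0 nat) set"
  where "expos N = {\<alpha>. mdeg \<alpha> \<le> N}"

lemma lookup_le_mdeg: "Poly_Mapping.lookup \<alpha> j \<le> mdeg \<alpha>"
  unfolding mdeg_def by (rule member_le_sum) auto

lemma expos_subset_box: "expos N \<subseteq> {\<alpha>. \<forall>j. Poly_Mapping.lookup \<alpha> j \<le> N}"
  using lookup_le_mdeg order_trans by (fastforce simp: expos_def)

lemma finite_expos [simp]: "finite (expos N)"
  using finite_subset[OF expos_subset_box finite_box] .

text \<open>
  The number of exponents is polynomial in \<open>N\<close>, but an exponential bound with a base close to one
  is easier to obtain, by comparing with a product of geometric series, and sufficient.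
\<close>

lemma card_expos_le:
  "real (card (expos N :: ('d::finite \<Rightarrow>\<^sub>0 nat) set)) \<le> (10 / 9) ^ N * 10 ^ CARD('d)"
proof -
  let ?r = "9 / 10 :: real"
  let ?B = "{\<alpha> :: 'd \<Rightarrow>\<^sub>0 nat. \<forall>j. Poly_Mapping.lookup \<alpha> j \<le> N}"
  have "real (card (expos N :: ('d \<Rightarrow>\<^sub>0 nat) set)) * ?r ^ N = (\<Sum>\<alpha>\<in>(expos N :: ('d \<Rightarrow>\<^sub>0 nat) set). ?r ^ N)"
    by simp
  also have "\<dots> \<le> (\<Sum>\<alpha>\<in>(expos N :: ('d \<Rightarrow>\<^sub>0 nat) set). ?r ^ mdeg \<alpha>)"
    by (intro sum_mono power_decreasing) (auto simp: expos_def)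
  also have "\<dots> \<le> (\<Sum>\<alpha>\<in>?B. ?r ^ mdeg \<alpha>)"
    by (intro sum_mono2 finite_box expos_subset_box) auto
  also have "\<dots> = (\<Sum>\<alpha>\<in>?B. \<Prod>j\<in>UNIV. ?r ^ Poly_Mapping.lookup \<alpha> j)"
    by (simp add: mdeg_def power_sum)
  also have "\<dots> = (\<Prod>j\<in>(UNIV :: 'd set). \<Sum>k\<le>N. ?r ^ k)"
    by (rule sum_box_prod)
  also have "\<dots> \<le> (\<Prod>j\<in>(UNIV :: 'd set). 10)"
  proof (intro prod_mono conjI)
    have "(\<Sum>k\<le>N. ?r ^ k) = 10 * (1 - ?r ^ Suc N)"
      by (induction N) simp_all
    then show "(\<Sum>k\<le>N. ?r ^ k) \<le> 10" by simp
  qed (simp add: sum_nonneg)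
  finally show ?thesis
    by (simp add: power_divide field_simps)
qed

lemma sqrt_prod: "sqrt (\<Prod>j\<in>J. f j) = (\<Prod>j\<in>J. sqrt (f j))"
  by (induction J rule: infinite_finite_induct) (auto simp: real_sqrt_mult)

section \<open>Absorbing small polynomials\<close>

lemma wgt_ge_1:
  assumes "t \<le> 1"
  shows "wgt t \<alpha> \<ge> 1"
  unfolding wgt_def using assms by (intro ge_one_powr_ge_zero) auto

lemma is_sos_penalty: "is_sos (penalty N t)"
  unfolding penalty_def by (intro is_sos_sum is_sos_pconst_mult is_sos_sqn_power) simp

lemma is_sos_add_penalty_mono:
  assumes "is_sos (q + pconst a * penalty N t)" and "a \<le> b"
  shows "is_sos (q + pconst b * penalty N t)"
proof -
  have "q + pconst b * penalty N t = (q + pconst a * penalty N t) + pconst (b - a) * penalty N t"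
    by (simp add: pconst_diff algebra_simps)
  then show ?thesis
    using is_sos_add[OF assms(1) is_sos_pconst_mult[OF _ is_sos_penalty, of "b - a"]] assms(2)
    by (simp only: diff_ge_0_iff_ge)
qed

lemma is_sos_sum_add_penalty:
  assumes "\<And>i. i \<in> I \<Longrightarrow> is_sos (f i + pconst (a i) * penalty N t)" and "(\<Sum>i\<in>I. a i) \<le> b"
  shows "is_sos ((\<Sum>i\<in>I. f i) + pconst b * penalty N t)"
proof -
  have "is_sos (\<Sum>i\<in>I. f i + pconst (a i) * penalty N t)"
    using assms(1) by (rule is_sos_sum)
  then show ?thesis
    by (intro is_sos_add_penalty_mono[OF _ assms(2)])
       (simp add: sum.distrib sum_distrib_right pconst_sum)
qed

text \<open>
  The norm weights are \<open>\<surd>(\<gamma>!)\<close> because \<open>\<alpha>! \<beta>! \<le> \<gamma>!\<close> for every splitting \<open>\<gamma> = \<alpha> + \<beta>\<close>.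
\<close>

lemma is_sos_low_degree_add_penalty:
  assumes "t \<le> 1" and "\<And>\<gamma>. \<gamma> \<in> G \<Longrightarrow> mdeg \<gamma> \<le> 2 * N"
    and "(\<Sum>\<gamma>\<in>G. \<bar>c \<gamma>\<bar> * sqrt (mfact \<gamma>)) \<le> b"
  shows "is_sos ((\<Sum>\<gamma>\<in>G. pconst (c \<gamma>) * mon \<gamma>) + pconst b * penalty N t)"
proof (rule is_sos_sum_add_penalty[OF _ assms(3)])
  fix \<gamma> assume "\<gamma> \<in> G"
  then obtain \<alpha> \<beta> where \<gamma>: "\<gamma> = \<alpha> + \<beta>" and deg: "mdeg \<alpha> \<le> N" "mdeg \<beta> \<le> N"
    using assms(2) exponent_split by metis
  have "sqrt (mfact \<alpha> * mfact \<beta>) \<le> sqrt (mfact \<gamma>)"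
    unfolding \<gamma> by (intro real_sqrt_le_mono mfact_mult_le)
  also have "\<dots> \<le> sqrt (mfact \<gamma>) * sqrt (wgt t \<alpha> * wgt t \<beta>)"
    using mult_mono[OF wgt_ge_1[OF assms(1)] wgt_ge_1[OF assms(1)], of \<alpha> \<beta>] mfact_pos[of \<gamma>]
    by (intro mult_le_cancel_left1[THEN iffD2]) (auto simp: wgt_def)
  finally have "\<bar>c \<gamma>\<bar> * sqrt (mfact \<alpha> * mfact \<beta>) \<le> \<bar>c \<gamma>\<bar> * (sqrt (mfact \<gamma>) * sqrt (wgt t \<alpha> * wgt t \<beta>))"
    by (intro mult_left_mono) auto
  then show "is_sos (pconst (c \<gamma>) * mon \<gamma> + pconst (\<bar>c \<gamma>\<bar> * sqrt (mfact \<gamma>)) * penalty N t)"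
    unfolding \<gamma> using deg by (intro is_sos_mon_add_penalty) (auto simp: mult_ac)
qed

section \<open>The truncated heat kernel\<close>

text \<open>
  The integral of \<open>p g\<^sub>\<alpha> g\<^sub>\<beta>\<close> against the centred Gaussian measure on \<open>\<real>\<^sup>d\<close> with covariance \<open>s\<close> times
  the identity, where \<open>g\<^sub>\<alpha>\<close> is the product over \<open>j\<close> of the polynomials \<open>hg s \<alpha>\<^sub>j\<close>.
\<close>

definition hcoeff :: "real \<Rightarrow> ('d::finite) mpoly \<Rightarrow> ('d \<Rightarrow>\<^sub>0 nat) \<Rightarrow> ('d \<Rightarrow>\<^sub>0 nat) \<Rightarrow> real"
  where "hcoeff s p \<alpha> \<beta> = (\<Sum>\<delta>\<in>Poly_Mapping.keys p. Poly_Mapping.lookup p \<delta> *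
    (\<Prod>j\<in>UNIV. hmom s (Poly_Mapping.lookup \<delta> j) (Poly_Mapping.lookup \<alpha> j) (Poly_Mapping.lookup \<beta> j)))"

lemma hcoeff_sym: "hcoeff s p \<alpha> \<beta> = hcoeff s p \<beta> \<alpha>"
  by (simp add: hcoeff_def hmom_sym[of s _ "Poly_Mapping.lookup \<alpha> _"])

lemma has_integral_prod_gauss:
  fixes q :: "'d::finite \<Rightarrow> real poly"
  assumes "s > 0"
  shows "has_bochner_integral (Pi\<^sub>M UNIV (\<lambda>_. gauss s)) (\<lambda>\<xi>. \<Prod>j\<in>UNIV. poly (q j) (\<xi> j))
    (\<Prod>j\<in>UNIV. gexp s (q j))"
proof -
  interpret prob_space "gauss s" by (rule prob_space_gauss[OF assms])
  interpret product_sigma_finite "\<lambda>_ :: 'd. gauss s"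
    by standard
  show ?thesis
    unfolding has_bochner_integral_iff gexp_def
    using integrable_poly_gauss[OF assms]
    by (intro conjI product_integrable_prod product_integral_prod) auto
qed

text \<open>The quadratic form is the integral of \<open>p\<close> times the square of \<open>\<Sum>\<^sub>\<alpha> v\<^sub>\<alpha> g\<^sub>\<alpha>\<close>.\<close>

lemma hcoeff_psd:
  fixes p :: "('d::finite) mpoly"
  assumes "s > 0" and nonneg: "\<And>\<xi> :: real ^ 'd. peval \<xi> p \<ge> 0"
  shows "(\<Sum>\<alpha>\<in>A. \<Sum>\<beta>\<in>A. hcoeff s p \<alpha> \<beta> * v \<alpha> * v \<beta>) \<ge> 0"
proof -
  define g where "g \<alpha> \<xi> = (\<Prod>j\<in>UNIV. poly (hg s (Poly_Mapping.lookup \<alpha> j)) (\<xi> j))"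
    for \<alpha> :: "'d \<Rightarrow>\<^sub>0 nat" and \<xi> :: "'d \<Rightarrow> real"
  define x where "x \<delta> \<xi> = (\<Prod>j\<in>UNIV. \<xi> j ^ Poly_Mapping.lookup \<delta> j)"
    for \<delta> :: "'d \<Rightarrow>\<^sub>0 nat" and \<xi> :: "'d \<Rightarrow> real"
  let ?F = "\<lambda>\<xi>. \<Sum>\<alpha>\<in>A. \<Sum>\<beta>\<in>A. (\<Sum>\<delta>\<in>Poly_Mapping.keys p. Poly_Mapping.lookup p \<delta> * (x \<delta> \<xi> * g \<alpha> \<xi> * g \<beta> \<xi>)) * v \<alpha> * v \<beta>"
  have "has_bochner_integral (Pi\<^sub>M UNIV (\<lambda>_. gauss s)) (\<lambda>\<xi>. x \<delta> \<xi> * g \<alpha> \<xi> * g \<beta> \<xi>)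
      (\<Prod>j\<in>UNIV. hmom s (Poly_Mapping.lookup \<delta> j) (Poly_Mapping.lookup \<alpha> j) (Poly_Mapping.lookup \<beta> j))" for \<alpha> \<beta> \<delta>
    using has_integral_prod_gauss[OF assms(1), of "\<lambda>j. monom 1 (Poly_Mapping.lookup \<delta> j) * hg s (Poly_Mapping.lookup \<alpha> j) * hg s (Poly_Mapping.lookup \<beta> j)"]
    by (simp add: hmom_def x_def g_def prod.distrib poly_monom)
  then have int: "has_bochner_integral (Pi\<^sub>M UNIV (\<lambda>_. gauss s)) ?F (\<Sum>\<alpha>\<in>A. \<Sum>\<beta>\<in>A. hcoeff s p \<alpha> \<beta> * v \<alpha> * v \<beta>)"
    unfolding hcoeff_def
    by (intro has_bochner_integral_sum has_bochner_integral_mult_left has_bochner_integral_mult_right)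
  have "?F \<xi> = peval (\<chi> j. \<xi> j) p * (\<Sum>\<alpha>\<in>A. g \<alpha> \<xi> * v \<alpha>)\<^sup>2" for \<xi>
  proof -
    have "peval (\<chi> j. \<xi> j) p = (\<Sum>\<delta>\<in>Poly_Mapping.keys p. Poly_Mapping.lookup p \<delta> * x \<delta> \<xi>)"
      by (simp add: peval_def x_def)
    moreover have "(\<Sum>\<delta>\<in>Poly_Mapping.keys p. Poly_Mapping.lookup p \<delta> * (x \<delta> \<xi> * g \<alpha> \<xi> * g \<beta> \<xi>)) =
        (\<Sum>\<delta>\<in>Poly_Mapping.keys p. Poly_Mapping.lookup p \<delta> * x \<delta> \<xi>) * (g \<alpha> \<xi> * g \<beta> \<xi>)" for \<alpha> \<beta>
      unfolding sum_distrib_right by (simp add: mult_ac)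
    ultimately show ?thesis
      unfolding power2_eq_square sum_product
      by (simp add: sum_distrib_left mult_ac)
  qed
  then have "?F \<xi> \<ge> 0" for \<xi>
    using nonneg by simp
  then have "(\<integral>\<xi>. ?F \<xi> \<partial>Pi\<^sub>M UNIV (\<lambda>_. gauss s)) \<ge> 0"
    by (rule Bochner_Integration.integral_nonneg)
  then show ?thesis
    using int by (simp add: has_bochner_integral_iff)
qed

lemma abs_hcoeff_le:
  assumes "s > 0" and "3 * s \<le> 1"
  shows "\<bar>hcoeff s p \<alpha> \<beta>\<bar> * sqrt (mfact \<alpha> * mfact \<beta>) \<le> pnorm p * sqrt (3 / (4 * s)) ^ (mdeg \<alpha> + mdeg \<beta>)"
proof -
  let ?l = Poly_Mapping.lookup
  let ?L = "sqrt (3 / (4 * s))"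
  have term_le: "\<bar>\<Prod>j\<in>UNIV. hmom s (?l \<delta> j) (?l \<alpha> j) (?l \<beta> j)\<bar> * sqrt (mfact \<alpha> * mfact \<beta>)
      \<le> sqrt (mfact \<delta>) * ?L ^ (mdeg \<alpha> + mdeg \<beta>)" for \<delta>
  proof -
    have "\<bar>\<Prod>j\<in>UNIV. hmom s (?l \<delta> j) (?l \<alpha> j) (?l \<beta> j)\<bar> * sqrt (mfact \<alpha> * mfact \<beta>) =
        (\<Prod>j\<in>UNIV. \<bar>hmom s (?l \<delta> j) (?l \<alpha> j) (?l \<beta> j)\<bar> * sqrt (fact (?l \<alpha> j) * fact (?l \<beta> j)))"
      unfolding mfact_def prod.distrib[symmetric] sqrt_prod abs_prod ..
    also have "\<dots> \<le> (\<Prod>j\<in>UNIV. sqrt (fact (?l \<delta> j)) * ?L ^ (?l \<alpha> j + ?l \<beta> j))"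
      by (intro prod_mono conjI abs_hmom_le[OF assms]) auto
    also have "\<dots> = sqrt (mfact \<delta>) * ?L ^ (mdeg \<alpha> + mdeg \<beta>)"
      unfolding prod.distrib mfact_def sqrt_prod mdeg_def sum.distrib[symmetric] by (simp add: power_sum)
    finally show ?thesis .
  qed
  have "\<bar>hcoeff s p \<alpha> \<beta>\<bar> \<le> (\<Sum>\<delta>\<in>Poly_Mapping.keys p. \<bar>?l p \<delta>\<bar> * \<bar>\<Prod>j\<in>UNIV. hmom s (?l \<delta> j) (?l \<alpha> j) (?l \<beta> j)\<bar>)"
    unfolding hcoeff_def by (rule order_trans[OF sum_abs]) (simp add: abs_mult)
  then have "\<bar>hcoeff s p \<alpha> \<beta>\<bar> * sqrt (mfact \<alpha> * mfact \<beta>) \<le>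
      (\<Sum>\<delta>\<in>Poly_Mapping.keys p. \<bar>?l p \<delta>\<bar> * \<bar>\<Prod>j\<in>UNIV. hmom s (?l \<delta> j) (?l \<alpha> j) (?l \<beta> j)\<bar>) * sqrt (mfact \<alpha> * mfact \<beta>)"
    using mfact_pos[of \<alpha>] mfact_pos[of \<beta>] by (intro mult_right_mono) auto
  also have "\<dots> = (\<Sum>\<delta>\<in>Poly_Mapping.keys p. \<bar>?l p \<delta>\<bar> * (\<bar>\<Prod>j\<in>UNIV. hmom s (?l \<delta> j) (?l \<alpha> j) (?l \<beta> j)\<bar> * sqrt (mfact \<alpha> * mfact \<beta>)))"
    unfolding sum_distrib_right mult.assoc ..
  also have "\<dots> \<le> (\<Sum>\<delta>\<in>Poly_Mapping.keys p. \<bar>?l p \<delta>\<bar> * (sqrt (mfact \<delta>) * ?L ^ (mdeg \<alpha> + mdeg \<beta>)))"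
    by (intro sum_mono mult_left_mono term_le) auto
  also have "\<dots> = pnorm p * ?L ^ (mdeg \<alpha> + mdeg \<beta>)"
    unfolding pnorm_def sum_distrib_right mult.assoc ..
  finally show ?thesis .
qed

text \<open>The coefficients of the heat flow \<open>E p(x + \<xi>)\<close> of \<open>p\<close>.\<close>

definition heat :: "real \<Rightarrow> ('d::finite) mpoly \<Rightarrow> ('d \<Rightarrow>\<^sub>0 nat) \<Rightarrow> real"
  where "heat s p \<gamma> = (\<Sum>\<delta>\<in>Poly_Mapping.keys p. Poly_Mapping.lookup p \<delta> *
    (\<Prod>j\<in>UNIV. real (Poly_Mapping.lookup \<delta> j choose Poly_Mapping.lookup \<gamma> j)
      * gmom s (Poly_Mapping.lookup \<delta> j - Poly_Mapping.lookup \<gamma> j)))"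

text \<open>For \<open>|\<gamma>| \<le> N\<close> every decomposition \<open>\<gamma> = \<alpha> + \<beta>\<close> survives the truncation at degree \<open>N\<close>.\<close>

lemma sum_hcoeff_antidiagonal:
  fixes p :: "('d::finite) mpoly"
  assumes "s > 0" and "mdeg \<gamma> \<le> N"
  shows "(\<Sum>(\<alpha>, \<beta>) | (\<alpha>, \<beta>) \<in> expos N \<times> expos N \<and> \<alpha> + \<beta> = \<gamma>. hcoeff s p \<alpha> \<beta>) = heat s p \<gamma>"
proof -
  let ?l = Poly_Mapping.lookup
  let ?B = "{\<alpha>. \<forall>j. ?l \<alpha> j \<le> ?l \<gamma> j}"
  have bij: "bij_betw (\<lambda>\<alpha>. (\<alpha>, \<gamma> - \<alpha>)) ?B {(\<alpha>, \<beta>). (\<alpha>, \<beta>) \<in> expos N \<times> expos N \<and> \<alpha> + \<beta> = \<gamma>}"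
  proof (rule bij_betwI[where g = fst])
    show "(\<lambda>\<alpha>. (\<alpha>, \<gamma> - \<alpha>)) \<in> ?B \<rightarrow> {(\<alpha>, \<beta>). (\<alpha>, \<beta>) \<in> expos N \<times> expos N \<and> \<alpha> + \<beta> = \<gamma>}"
    proof
      fix \<alpha> assume "\<alpha> \<in> ?B"
      then have *: "\<alpha> + (\<gamma> - \<alpha>) = \<gamma>"
        by (intro poly_mapping_eqI) (auto simp: lookup_add lookup_minus)
      then have "mdeg \<alpha> + mdeg (\<gamma> - \<alpha>) \<le> N"
        using assms(2) mdeg_add by metis
      then show "(\<alpha>, \<gamma> - \<alpha>) \<in> {(\<alpha>, \<beta>). (\<alpha>, \<beta>) \<in> expos N \<times> expos N \<and> \<alpha> + \<beta> = \<gamma>}"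
        using * by (simp add: expos_def)
    qed
    show "fst \<in> {(\<alpha>, \<beta>). (\<alpha>, \<beta>) \<in> expos N \<times> expos N \<and> \<alpha> + \<beta> = \<gamma>} \<rightarrow> ?B"
      by (auto simp: lookup_add)
  qed auto
  have "(\<Sum>(\<alpha>, \<beta>) | (\<alpha>, \<beta>) \<in> expos N \<times> expos N \<and> \<alpha> + \<beta> = \<gamma>. hcoeff s p \<alpha> \<beta>) = (\<Sum>\<alpha>\<in>?B. hcoeff s p \<alpha> (\<gamma> - \<alpha>))"
    using sum.reindex_bij_betw[OF bij, of "\<lambda>(\<alpha>, \<beta>). hcoeff s p \<alpha> \<beta>"] by simp
  also have "\<dots> = (\<Sum>\<delta>\<in>Poly_Mapping.keys p. ?l p \<delta> * (\<Sum>\<alpha>\<in>?B. \<Prod>j\<in>UNIV. hmom s (?l \<delta> j) (?l \<alpha> j) (?l \<gamma> j - ?l \<alpha> j)))"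
    unfolding hcoeff_def lookup_minus sum_distrib_left by (rule sum.swap)
  also have "\<dots> = heat s p \<gamma>"
    unfolding heat_def sum_box_prod[where f = "\<lambda>j k. hmom s (?l _ j) k (?l \<gamma> j - k)"] sum_hmom_antidiagonal[OF assms(1)] ..
  finally show ?thesis .
qed

text \<open>
  The heat flow moves \<open>p\<close> by little in the norm.  All coefficients of the heat flow of a monomial
  are nonnegative, and the monomial itself occurs with coefficient one.
\<close>

lemma heat_diff_norm_le:
  fixes p :: "('d::finite) mpoly"
  assumes "s > 0" and "pdegree p \<le> 2 * M" and "2 * M \<le> N"
  shows "(\<Sum>\<gamma>\<in>expos N. \<bar>Poly_Mapping.lookup p \<gamma> - heat s p \<gamma>\<bar> * sqrt (mfact \<gamma>)) \<le> (exp (s * real M) - 1) * pnorm p"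
proof -
  let ?l = Poly_Mapping.lookup
  define w where "w \<delta> \<gamma> = (\<Prod>j\<in>UNIV. real (?l \<delta> j choose ?l \<gamma> j) * gmom s (?l \<delta> j - ?l \<gamma> j))" for \<delta> \<gamma> :: "'d \<Rightarrow>\<^sub>0 nat"
  have w_nonneg: "w \<delta> \<gamma> \<ge> 0" for \<delta> \<gamma>
    unfolding w_def using gmom_nonneg[OF assms(1)] by (intro prod_nonneg) auto
  have w_refl: "w \<delta> \<delta> = 1" for \<delta>
    by (simp add: w_def gmom_def)
  define w' where "w' \<delta> \<gamma> = w \<delta> \<gamma> - (if \<gamma> = \<delta> then 1 else 0)" for \<delta> \<gamma>
  have w'_nonneg: "w' \<delta> \<gamma> \<ge> 0" for \<delta> \<gamma>
    using w_nonneg w_refl by (simp add: w'_def)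
  have diff: "\<bar>?l p \<gamma> - heat s p \<gamma>\<bar> \<le> (\<Sum>\<delta>\<in>Poly_Mapping.keys p. \<bar>?l p \<delta>\<bar> * w' \<delta> \<gamma>)" for \<gamma>
  proof -
    have "?l p \<gamma> = (\<Sum>\<delta>\<in>Poly_Mapping.keys p. ?l p \<delta> * (if \<gamma> = \<delta> then 1 else 0))"
      by (cases "\<gamma> \<in> Poly_Mapping.keys p") (auto simp: in_keys_iff if_distrib cong: if_cong)
    then have "heat s p \<gamma> - ?l p \<gamma> = (\<Sum>\<delta>\<in>Poly_Mapping.keys p. ?l p \<delta> * w' \<delta> \<gamma>)"
      unfolding heat_def w'_def w_def[symmetric] right_diff_distrib sum_subtractf by simp
    then have "\<bar>?l p \<gamma> - heat s p \<gamma>\<bar> = \<bar>\<Sum>\<delta>\<in>Poly_Mapping.keys p. ?l p \<delta> * w' \<delta> \<gamma>\<bar>"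
      by (metis abs_minus_commute)
    also have "\<dots> \<le> (\<Sum>\<delta>\<in>Poly_Mapping.keys p. \<bar>?l p \<delta>\<bar> * w' \<delta> \<gamma>)"
      using w'_nonneg by (intro order_trans[OF sum_abs]) (simp add: abs_mult)
    finally show ?thesis .
  qed
  have mono_le: "(\<Sum>\<gamma>\<in>expos N. w' \<delta> \<gamma> * sqrt (mfact \<gamma>)) \<le> (exp (s * real M) - 1) * sqrt (mfact \<delta>)"
    if "\<delta> \<in> Poly_Mapping.keys p" for \<delta>
  proof -
    have deg: "mdeg \<delta> \<le> 2 * M" using mdeg_le_pdegree[OF that] assms(2) by simp
    let ?B = "{\<gamma>. \<forall>j. ?l \<gamma> j \<le> ?l \<delta> j}"
    have sub: "?B \<subseteq> expos N"
    proof
      fix \<gamma> assume "\<gamma> \<in> ?B"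
      then have "mdeg \<gamma> \<le> mdeg \<delta>" unfolding mdeg_def by (intro sum_mono) auto
      then show "\<gamma> \<in> expos N" using deg assms(3) by (simp add: expos_def)
    qed
    have "(\<Sum>\<gamma>\<in>expos N. w \<delta> \<gamma> * sqrt (mfact \<gamma>)) = (\<Sum>\<gamma>\<in>?B. w \<delta> \<gamma> * sqrt (mfact \<gamma>))"
    proof (rule sum.mono_neutral_right[OF _ sub])
      show "\<forall>\<gamma>\<in>expos N - ?B. w \<delta> \<gamma> * sqrt (mfact \<gamma>) = 0"
      proof
        fix \<gamma> assume "\<gamma> \<in> expos N - ?B"
        then obtain j where "?l \<delta> j < ?l \<gamma> j" by (auto simp: not_le)
        then have "w \<delta> \<gamma> = 0"
          unfolding w_def by (intro prod_zero) (auto intro!: exI[of _ j] simp: binomial_eq_0)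
        then show "w \<delta> \<gamma> * sqrt (mfact \<gamma>) = 0" by simp
      qed
    qed simp
    also have "\<dots> = (\<Prod>j\<in>UNIV. \<Sum>k\<le>?l \<delta> j. real (?l \<delta> j choose k) * gmom s (?l \<delta> j - k) * sqrt (fact k))"
      unfolding w_def mfact_def sqrt_prod prod.distrib[symmetric] by (rule sum_box_prod)
    also have "\<dots> \<le> (\<Prod>j\<in>UNIV. sqrt (fact (?l \<delta> j)) * exp (s * real (?l \<delta> j) / 2))"
      using gmom_nonneg[OF assms(1)]
      by (intro prod_mono conjI heat_flow_norm_le[OF assms(1)] sum_nonneg) auto
    also have "\<dots> = sqrt (mfact \<delta>) * exp (s * real (mdeg \<delta>) / 2)"
      unfolding prod.distrib mfact_def sqrt_prod mdeg_def
      by (simp add: exp_sum[symmetric] sum_divide_distrib sum_distrib_left)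
    also have "\<dots> \<le> sqrt (mfact \<delta>) * exp (s * real M)"
      using deg assms(1) mfact_pos[of \<delta>] by (intro mult_left_mono) auto
    finally have main: "(\<Sum>\<gamma>\<in>expos N. w \<delta> \<gamma> * sqrt (mfact \<gamma>)) \<le> sqrt (mfact \<delta>) * exp (s * real M)" .
    have "(\<Sum>\<gamma>\<in>expos N. (if \<gamma> = \<delta> then 1 else 0) * sqrt (mfact \<gamma>)) = sqrt (mfact \<delta>)"
    proof -
      have "(\<Sum>\<gamma>\<in>expos N. (if \<gamma> = \<delta> then 1 else 0) * sqrt (mfact \<gamma>)) =
          (\<Sum>\<gamma>\<in>expos N. if \<gamma> = \<delta> then sqrt (mfact \<gamma>) else 0)"
        by (intro sum.cong) auto
      moreover have "\<delta> \<in> expos N"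
        using deg assms(3) by (simp add: expos_def)
      ultimately show ?thesis by simp
    qed
    then show ?thesis
      using main unfolding w'_def left_diff_distrib sum_subtractf by (simp add: mult.commute)
  qed
  have "(\<Sum>\<gamma>\<in>expos N. \<bar>?l p \<gamma> - heat s p \<gamma>\<bar> * sqrt (mfact \<gamma>))
      \<le> (\<Sum>\<gamma>\<in>expos N. (\<Sum>\<delta>\<in>Poly_Mapping.keys p. \<bar>?l p \<delta>\<bar> * w' \<delta> \<gamma>) * sqrt (mfact \<gamma>))"
    using less_imp_le[OF mfact_pos] by (intro sum_mono mult_right_mono diff) simp_all
  also have "\<dots> = (\<Sum>\<delta>\<in>Poly_Mapping.keys p. \<bar>?l p \<delta>\<bar> * (\<Sum>\<gamma>\<in>expos N. w' \<delta> \<gamma> * sqrt (mfact \<gamma>)))"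
    unfolding sum_distrib_right sum_distrib_left mult.assoc by (rule sum.swap)
  also have "\<dots> \<le> (\<Sum>\<delta>\<in>Poly_Mapping.keys p. \<bar>?l p \<delta>\<bar> * ((exp (s * real M) - 1) * sqrt (mfact \<delta>)))"
    by (intro sum_mono mult_left_mono mono_le) auto
  also have "\<dots> = (exp (s * real M) - 1) * pnorm p"
    by (simp add: pnorm_def sum_distrib_left mult_ac)
  finally show ?thesis .
qed

section \<open>Numerical estimates\<close>

lemma exp_1_ge: "exp (1 :: real) \<ge> 27 / 10"
proof -
  have "(27 / 10 :: real) \<le> (1 + 1 / 5 + (1 / 5)\<^sup>2 / 2) ^ 5"
    by (simp add: power_divide field_simps)
  also have "\<dots> \<le> exp (1 / 5) ^ 5"
    by (intro power_mono exp_lower_Taylor_quadratic) auto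
  also have "\<dots> = exp (1 :: real)"
    by (simp flip: exp_of_nat_mult)
  finally show ?thesis .
qed

lemma mu_ge:
  assumes "d \<ge> 1" and "M \<ge> 1"
  shows "mu d M \<ge> 2 * real d * real M"
proof -
  have "real d * real d / 2 \<le> real ((d + 1) choose (d - 1))"
  proof -
    have "(d + 1) choose (d - 1) = (d + 1) choose 2"
      using assms(1) binomial_symmetric[of "d - 1" "d + 1"] by simp
    moreover have "2 * ((d + 1) choose 2) = (d + 1) * d"
      by (simp add: choose_two)
    ultimately have "2 * ((d + 1) choose (d - 1)) \<ge> d * d" by simp
    then have "real (d * d) \<le> real (2 * ((d + 1) choose (d - 1)))" by (rule of_nat_mono)
    then show ?thesis by simp
  qed
  also have "(d + 1) choose (d - 1) \<le> (2 * M + d - 1) choose (d - 1)"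
    using assms by (intro binomial_right_mono) auto
  finally have "sqrt (real d * real d / 2) \<le> sqrt (real ((2 * M + d - 1) choose (d - 1)))"
    by (intro real_sqrt_le_mono) simp
  moreover have "2 powr (real M + 1 / 2) \<ge> sqrt 8"
  proof -
    have "sqrt (8 :: real) = 2 powr (3 / 2)"
      by (rule real_sqrt_unique) (simp_all add: powr_power)
    also have "\<dots> \<le> 2 powr (real M + 1 / 2)"
      using assms by (intro powr_mono) auto
    finally show ?thesis .
  qed
  ultimately have "real M * sqrt (real d * real d / 2) * sqrt 8 \<le> mu d M"
    unfolding mu_def by (intro mult_mono mult_left_mono) auto
  moreover have "sqrt (real d * real d / 2) * sqrt 8 = 2 * real d"
    by (simp flip: real_sqrt_mult add: real_sqrt_unique power2_eq_square)
  ultimately show ?thesis by (simp add: mult_ac)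
qed

text \<open>
  With \<open>Z = X\<^bsup>1/(1-t)\<^esup>\<close> and \<open>n = a + b\<close>, this follows from \<open>n\<^sup>n \<le> e\<^sup>n n!\<close> and \<open>n! \<le> 2\<^sup>n a! b!\<close>, which
  together give \<open>Z\<^sup>n \<le> a! b!\<close>.
\<close>

lemma power_le_fact_powr:
  assumes "X > 0" and "t < 1" and "2 * exp 1 * X powr (1 / (1 - t)) \<le> real (a + b)"
  shows "X ^ (a + b) \<le> fact a powr (1 - t) * fact b powr (1 - t)"
proof -
  define n where "n = a + b"
  define Z where "Z = X powr (1 / (1 - t))"
  have Z: "Z > 0" using assms(1) by (simp add: Z_def)
  have "(2 * Z) ^ n * exp (real n) = (2 * exp 1 * Z) ^ n"
    by (simp add: power_mult_distrib flip: exp_of_nat_mult)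
  also have "\<dots> \<le> real n ^ n"
    using assms(3) Z by (intro power_mono) (auto simp: n_def Z_def)
  also have "real n ^ n / fact n \<le> exp (real n)"
  proof -
    have "(\<Sum>k\<in>{n}. real n ^ k /\<^sub>R fact k) \<le> exp (real n)"
      unfolding exp_def by (intro sum_le_suminf summable_exp_generic) auto
    then show ?thesis by (simp add: divide_inverse mult.commute)
  qed
  then have "real n ^ n \<le> fact n * exp (real n)"
    by (simp add: divide_le_eq mult.commute)
  finally have "(2 * Z) ^ n \<le> fact n" by simp
  also have "fact n = fact a * fact b * real (n choose a)"
    using binomial_fact_lemma[of a n] unfolding n_def
    by (metis (no_types) add_diff_cancel_left' le_add1 of_nat_fact of_nat_mult)
  also have "real (n choose a) \<le> 2 ^ n"
    using binomial_le_pow2[of n a] by (metis of_nat_le_iff of_nat_numeral of_nat_power)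
  finally have "Z ^ n \<le> fact a * fact b"
    by (simp add: power_mult_distrib mult.commute)
  then have "(Z ^ n) powr (1 - t) \<le> (fact a * fact b) powr (1 - t)"
    using assms(2) Z by (intro powr_mono2) auto
  moreover have "(Z ^ n) powr (1 - t) = X ^ n"
  proof -
    have "(Z ^ n) powr (1 - t) = Z powr (real n * (1 - t))"
      using Z by (simp add: powr_realpow[symmetric] powr_powr)
    also have "\<dots> = X powr real n"
      using assms(2) by (simp add: Z_def powr_powr)
    finally show ?thesis using assms(1) by (simp add: powr_realpow)
  qed
  ultimately show ?thesis by (simp add: n_def powr_mult)
qed

text \<open>
  The first factor bounds the number of pairs of exponents.  The decay prevails because
  \<open>(10/9)\<^sup>2 (2/3) = 200/243 < 1\<close>.
\<close>

lemma tail_small: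
  fixes S d :: real
  assumes "S \<ge> 1" and "d \<ge> 1" and "16 * exp 1 * (d * S) \<le> real N" and "d = real k"
  shows "((10 / 9) ^ N * 10 ^ k)\<^sup>2 * (S * (2 / 3) ^ N) \<le> 1 / 2"
proof -
  have dS: "d * S \<ge> d" "d * S \<ge> S" "d * S \<ge> 1"
    using assms(1,2) mult_mono[of 1 d 1 S] mult_left_mono[of 1 S d] mult_right_mono[of 1 d S] by auto
  have N: "real N \<ge> 216 / 5 * (d * S)"
    using mult_right_mono[OF exp_1_ge, of "16 * (d * S)"] assms(3) dS(3) by (simp add: mult_ac)
  have "((10 / 9) ^ N * 10 ^ k)\<^sup>2 * (S * (2 / 3) ^ N) = S * 100 ^ k * (200 / 243) ^ N"
  proof -
    have "((10 / 9) ^ N * 10 ^ k :: real)\<^sup>2 = ((10 / 9)\<^sup>2) ^ N * (10\<^sup>2) ^ k"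
      by (simp only: power_mult_distrib power_mult[symmetric] mult.commute)
    then have "((10 / 9) ^ N * 10 ^ k :: real)\<^sup>2 = (100 / 81) ^ N * 100 ^ k"
      by (simp add: power_divide)
    moreover have "(100 / 81 :: real) ^ N * (2 / 3) ^ N = (200 / 243) ^ N"
      by (simp flip: power_mult_distrib)
    ultimately show ?thesis by (simp add: mult_ac)
  qed
  also have "\<dots> \<le> exp S * exp 5 ^ k * exp (- 43 / 243) ^ N"
  proof (intro mult_mono power_mono)
    show "S \<le> exp S" using exp_ge_add_one_self[of S] by linarith
    have "(100 :: real) \<le> (27 / 10) ^ 5" by (simp add: power_divide)
    also have "\<dots> \<le> exp 1 ^ 5" by (intro power_mono exp_1_ge) auto
    also have "\<dots> = exp (5 :: real)" by (simp flip: exp_of_nat_mult)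
    finally show "(100 :: real) \<le> exp 5" .
    show "200 / 243 \<le> exp (- 43 / 243 :: real)"
      using exp_ge_add_one_self[of "- 43 / 243 :: real"] by simp
  qed (use assms in auto)
  also have "\<dots> = exp (S + 5 * d - 43 / 243 * real N)"
    by (simp add: assms(4) exp_add[symmetric] exp_diff exp_minus exp_of_nat_mult[symmetric] field_simps)
  \<comment> \<open>Since \<open>S + 5 d \<le> 6 d S\<close>, it matters that \<open>43/243\<close> times \<open>216/5\<close> exceeds \<open>7\<close>.\<close>
  also have "\<dots> \<le> exp (- 1)"
    using N dS by simp
  also have "\<dots> \<le> 1 / 2"
    using exp_1_ge by (simp add: exp_minus divide_simps)
  finally show ?thesis .
qed

section \<open>The perturbed polynomial\<close>

text \<open>
  This is the case \<open>\<epsilon> = 1\<close>.  If the norm \<open>S\<close> of \<open>p\<close> is at most one, then \<open>p\<close> can be absorbed directly.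
  Otherwise the heat flow is run up to the time \<open>s = 1 / (4 M S)\<close>: half of the penalty polynomial
  pays for the distance from \<open>p\<close> to its heat flow, the other half for the truncation of the kernel.
\<close>

lemma is_sos_add_penalty:
  fixes p :: "('d::finite) mpoly"
  assumes M: "M \<ge> 1" and deg: "pdegree p \<le> 2 * M" and t: "0 \<le> t" "t < 1"
    and nonneg: "\<And>\<xi> :: real ^ 'd. peval \<xi> p \<ge> 0"
    and N_deg: "2 * M \<le> N"
    and N: "2 * exp 1 * (4 * mu CARD('d) M * pnorm p) powr (1 / (1 - t)) \<le> real N"
  shows "is_sos (p + penalty N t)"
proof (cases "pnorm p \<le> 1")
  case True
  have "is_sos ((\<Sum>\<gamma>\<in>Poly_Mapping.keys p. pconst (Poly_Mapping.lookup p \<gamma>) * mon \<gamma>) + pconst 1 * penalty N t)"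
    using True t N_deg order_trans[OF mdeg_le_pdegree deg]
    by (intro is_sos_low_degree_add_penalty) (force simp: pnorm_def)+
  then show ?thesis
    by (simp flip: mpoly_eq_sum_mon)
next
  case False
  define S where "S = pnorm p"
  define d where "d = real CARD('d)"
  define X where "X = 4 * mu CARD('d) M * S"
  define s where "s = 1 / (4 * real M * S)"
  have S: "S > 1" using False by (simp add: S_def)
  have d: "d \<ge> 1" by (simp add: d_def Suc_le_eq)
  have MS: "real M * S \<ge> 1"
    using M S mult_mono[of 1 "real M" 1 S] by simp
  have s: "s > 0" "3 * s \<le> 1"
    using M S MS by (simp_all add: s_def field_simps)
  have dMS: "d * (real M * S) \<ge> 1" "d * (real M * S) \<ge> real M * S" "d * (real M * S) \<ge> d * S"
    using d MS M S mult_mono[of 1 d 1 "real M * S"] mult_right_mono[of 1 d "real M * S"] mult_left_mono[of S "real M * S" d]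
      mult_right_mono[of 1 "real M" S] by auto
  have X_ge: "X \<ge> 8 * (d * (real M * S))"
  proof -
    have "2 * d * real M \<le> mu CARD('d) M"
      unfolding d_def using M by (intro mu_ge) (simp_all add: Suc_le_eq)
    then have "2 * d * real M * S \<le> mu CARD('d) M * S"
      using S by (intro mult_right_mono) auto
    then show ?thesis by (simp add: X_def mult_ac)
  qed
  have X: "X > 1" using X_ge dMS by linarith
  have N_X: "2 * exp 1 * X powr (1 / (1 - t)) \<le> real N"
    using N by (simp add: X_def S_def)
  have N_ge: "16 * exp 1 * (d * S) \<le> real N"
  proof -
    have "X powr 1 \<le> X powr (1 / (1 - t))"
      using X t by (intro powr_mono) (auto simp: field_simps)
    then have "8 * (d * S) \<le> X powr (1 / (1 - t))"
      using X X_ge dMS by simp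
    then have "2 * exp 1 * (8 * (d * S)) \<le> 2 * exp 1 * X powr (1 / (1 - t))"
      by (intro mult_left_mono) auto
    moreover have "2 * exp 1 * (8 * (d * S)) = 16 * exp 1 * (d * S)" by simp
    ultimately show ?thesis using N_X by linarith
  qed
  let ?C = "hcoeff s p"
  let ?m = "\<lambda>(\<alpha>, \<beta>). pconst (?C \<alpha> \<beta>) * mon (\<alpha> + \<beta>)"
  define A where "A = (expos N :: ('d \<Rightarrow>\<^sub>0 nat) set)"
  have finA: "finite A" by (simp add: A_def)
  define low where "low = {z \<in> A \<times> A. mdeg (fst z + snd z) \<le> N}"
  define high where "high = {z \<in> A \<times> A. mdeg (fst z + snd z) > N}"
  define K where "K = S * (2 / 3) ^ N"
  have "is_sos (\<Sum>\<alpha>\<in>A. \<Sum>\<beta>\<in>A. pconst (?C \<alpha> \<beta>) * mon \<alpha> * mon \<beta>)"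
    using hcoeff_psd[OF s(1) nonneg] by (intro is_sos_quadratic_form finA hcoeff_sym)
  also have "(\<Sum>\<alpha>\<in>A. \<Sum>\<beta>\<in>A. pconst (?C \<alpha> \<beta>) * mon \<alpha> * mon \<beta>) = (\<Sum>z\<in>A \<times> A. ?m z)"
    by (simp add: sum.cartesian_product mon_add mult.assoc)
  also have "\<dots> = (\<Sum>z\<in>low. ?m z) + (\<Sum>z\<in>high. ?m z)"
    using finA by (subst sum.union_disjoint[symmetric]) (auto simp: low_def high_def intro!: sum.cong)
  also have "(\<Sum>z\<in>low. ?m z) = (\<Sum>\<gamma>\<in>A. pconst (heat s p \<gamma>) * mon \<gamma>)"
  proof -
    have "(\<Sum>z\<in>low. ?m z) = (\<Sum>\<gamma>\<in>A. \<Sum>z | z \<in> low \<and> fst z + snd z = \<gamma>. ?m z)"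
      using finA by (intro sum.group[symmetric]) (auto simp: low_def A_def expos_def)
    also have "\<dots> = (\<Sum>\<gamma>\<in>A. pconst (heat s p \<gamma>) * mon \<gamma>)"
    proof (rule sum.cong[OF refl])
      fix \<gamma> assume "\<gamma> \<in> A"
      then have \<gamma>: "mdeg \<gamma> \<le> N" by (simp add: A_def expos_def)
      have "(\<Sum>z | z \<in> low \<and> fst z + snd z = \<gamma>. ?m z) =
          (\<Sum>(\<alpha>, \<beta>) | (\<alpha>, \<beta>) \<in> A \<times> A \<and> \<alpha> + \<beta> = \<gamma>. pconst (?C \<alpha> \<beta>) * mon \<gamma>)"
        using \<gamma> by (intro sum.cong) (auto simp: low_def)
      also have "\<dots> = pconst (\<Sum>(\<alpha>, \<beta>) | (\<alpha>, \<beta>) \<in> A \<times> A \<and> \<alpha> + \<beta> = \<gamma>. ?C \<alpha> \<beta>) * mon \<gamma>"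
        by (simp add: pconst_sum sum_distrib_right case_prod_unfold)
      finally show "(\<Sum>z | z \<in> low \<and> fst z + snd z = \<gamma>. ?m z) = pconst (heat s p \<gamma>) * mon \<gamma>"
        using sum_hcoeff_antidiagonal[OF s(1) \<gamma>, of p] by (simp add: A_def)
    qed
    finally show ?thesis .
  qed
  finally have main: "is_sos ((\<Sum>\<gamma>\<in>A. pconst (heat s p \<gamma>) * mon \<gamma>) + (\<Sum>z\<in>high. ?m z))" .
  have low_part: "is_sos ((\<Sum>\<gamma>\<in>A. pconst (Poly_Mapping.lookup p \<gamma> - heat s p \<gamma>) * mon \<gamma>) + pconst (1 / 2) * penalty N t)"
  proof (rule is_sos_low_degree_add_penalty)
    have "(\<Sum>\<gamma>\<in>A. \<bar>Poly_Mapping.lookup p \<gamma> - heat s p \<gamma>\<bar> * sqrt (mfact \<gamma>)) \<le> (exp (s * real M) - 1) * S"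
      unfolding A_def S_def by (rule heat_diff_norm_le[OF s(1) deg N_deg])
    also have "\<dots> \<le> 1 / (2 * S) * S"
    proof (rule mult_right_mono)
      define y where "y = s * real M"
      have y: "y = 1 / (4 * S)" using M S by (simp add: y_def s_def)
      have "exp y \<le> 1 + y + y\<^sup>2"
        using S unfolding y by (intro exp_bound) auto
      also have "y\<^sup>2 \<le> y"
        using S unfolding y power2_eq_square by (intro mult_left_le) auto
      finally show "exp (s * real M) - 1 \<le> 1 / (2 * S)"
        unfolding y_def[symmetric] y by simp
    qed (use S in simp)
    finally show "(\<Sum>\<gamma>\<in>A. \<bar>Poly_Mapping.lookup p \<gamma> - heat s p \<gamma>\<bar> * sqrt (mfact \<gamma>)) \<le> 1 / 2"
      using S by simp
  qed (use t in \<open>auto simp: A_def expos_def\<close>)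
  have high_part: "is_sos ((\<Sum>(\<alpha>, \<beta>)\<in>high. pconst (- ?C \<alpha> \<beta>) * mon (\<alpha> + \<beta>)) + pconst (1 / 2) * penalty N t)"
  proof (rule is_sos_sum_add_penalty[where a = "\<lambda>_. K"])
    fix z assume z: "z \<in> high"
    obtain \<alpha> \<beta> where z_eq: "z = (\<alpha>, \<beta>)" by fastforce
    define n where "n = mdeg \<alpha> + mdeg \<beta>"
    have \<alpha>: "mdeg \<alpha> \<le> N" and \<beta>: "mdeg \<beta> \<le> N" and n: "N < n"
      using z by (auto simp: z_eq high_def A_def expos_def mdeg_add n_def)
    have "X ^ n \<le> wgt t \<alpha> * wgt t \<beta>"
      unfolding wgt_def n_def using X t N_X n by (intro power_le_fact_powr) (auto simp: n_def)
    then have wgt: "sqrt X ^ n \<le> sqrt (wgt t \<alpha> * wgt t \<beta>)"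
      unfolding real_sqrt_power[symmetric] by (rule real_sqrt_le_mono)
    have L: "sqrt (3 / (4 * s)) \<le> 2 / 3 * sqrt X"
    proof -
      have "3 / (4 * s) = 3 * (real M * S)" using M S by (simp add: s_def)
      also have "\<dots> \<le> (2 / 3)\<^sup>2 * X" using X_ge dMS by (simp add: power2_eq_square)
      finally have "sqrt (3 / (4 * s)) \<le> sqrt ((2 / 3)\<^sup>2 * X)" by (rule real_sqrt_le_mono)
      then show ?thesis by (simp add: real_sqrt_mult)
    qed
    have "\<bar>- ?C \<alpha> \<beta>\<bar> * sqrt (mfact \<alpha> * mfact \<beta>) \<le> S * sqrt (3 / (4 * s)) ^ n"
      using abs_hcoeff_le[OF s, of p \<alpha> \<beta>] by (simp add: S_def n_def)
    also have "\<dots> \<le> S * (2 / 3 * sqrt X) ^ n"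
      using S s L by (intro mult_left_mono power_mono) auto
    also have "\<dots> = S * (2 / 3) ^ n * sqrt X ^ n"
      by (simp only: power_mult_distrib mult.assoc)
    also have "\<dots> \<le> S * (2 / 3) ^ N * sqrt (wgt t \<alpha> * wgt t \<beta>)"
      using S X n by (intro mult_mono wgt mult_left_mono power_decreasing) auto
    finally show "is_sos ((case z of (\<alpha>, \<beta>) \<Rightarrow> pconst (- ?C \<alpha> \<beta>) * mon (\<alpha> + \<beta>)) + pconst K * penalty N t)"
      unfolding z_eq K_def using \<alpha> \<beta> by (auto intro: is_sos_mon_add_penalty)
  next
    have K: "K \<ge> 0" using S by (simp add: K_def)
    have "card high \<le> card (A \<times> A)"
      using finA by (intro card_mono) (auto simp: high_def)
    then have "real (card high) \<le> (real (card A))\<^sup>2"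
      by (simp add: card_cartesian_product power2_eq_square flip: of_nat_mult)
    also have "\<dots> \<le> ((10 / 9) ^ N * 10 ^ CARD('d))\<^sup>2"
      unfolding A_def by (intro power_mono card_expos_le) auto
    finally have "real (card high) * K \<le> ((10 / 9) ^ N * 10 ^ CARD('d))\<^sup>2 * K"
      using K by (intro mult_right_mono)
    also have "\<dots> \<le> 1 / 2"
      unfolding K_def using S d N_ge by (intro tail_small[of S d]) (auto simp: d_def)
    finally show "(\<Sum>z\<in>high. K) \<le> 1 / 2" by simp
  qed
  have p: "p = (\<Sum>\<gamma>\<in>A. pconst (Poly_Mapping.lookup p \<gamma>) * mon \<gamma>)"
  proof -
    have "Poly_Mapping.keys p \<subseteq> A"
      using order_trans[OF order_trans[OF mdeg_le_pdegree deg] N_deg] by (auto simp: A_def expos_def)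
    then have "(\<Sum>\<gamma>\<in>Poly_Mapping.keys p. pconst (Poly_Mapping.lookup p \<gamma>) * mon \<gamma>) =
        (\<Sum>\<gamma>\<in>A. pconst (Poly_Mapping.lookup p \<gamma>) * mon \<gamma>)"
      using finA by (intro sum.mono_neutral_left) (auto simp: in_keys_iff)
    then show ?thesis using mpoly_eq_sum_mon[of p] by simp
  qed
  have half: "pconst (1 / 2) * penalty N t + pconst (1 / 2) * penalty N t = (penalty N t :: 'd mpoly)"
    by (simp flip: distrib_right pconst_add)
  have diff: "(\<Sum>\<gamma>\<in>A. pconst (Poly_Mapping.lookup p \<gamma> - heat s p \<gamma>) * mon \<gamma>) =
      p - (\<Sum>\<gamma>\<in>A. pconst (heat s p \<gamma>) * mon \<gamma>)"
    by (subst (2) p) (simp only: pconst_diff left_diff_distrib sum_subtractf)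
  have neg: "(\<Sum>(\<alpha>, \<beta>)\<in>high. pconst (- ?C \<alpha> \<beta>) * mon (\<alpha> + \<beta>)) = - (\<Sum>z\<in>high. ?m z)"
    by (simp add: pconst_uminus sum_negf case_prod_unfold)
  have "p + penalty N t =
      ((\<Sum>\<gamma>\<in>A. pconst (heat s p \<gamma>) * mon \<gamma>) + (\<Sum>z\<in>high. ?m z))
      + ((\<Sum>\<gamma>\<in>A. pconst (Poly_Mapping.lookup p \<gamma> - heat s p \<gamma>) * mon \<gamma>) + pconst (1 / 2) * penalty N t)
      + ((\<Sum>(\<alpha>, \<beta>)\<in>high. pconst (- ?C \<alpha> \<beta>) * mon (\<alpha> + \<beta>)) + pconst (1 / 2) * penalty N t)"
    unfolding diff neg by (subst half[symmetric]) (simp add: algebra_simps)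
  then show ?thesis
    using is_sos_add[OF is_sos_add[OF main low_part] high_part] by (simp only:)
qed

theorem theorem2:
  fixes p :: "('d::finite) mpoly" and M :: nat and t \<epsilon> :: real
  assumes "M \<ge> 1"
    and "pdegree p \<le> 2 * M"
    and "0 \<le> t" and "t < 1"
    and "\<epsilon> > 0"
    and "\<And>\<xi> :: real ^ 'd. peval \<xi> p \<ge> 0"
  shows "is_sos (p + pconst \<epsilon> *
    (\<Sum>n = 0..N_expl M t \<epsilon> p. pconst (1 / (fact n powr t)) * (\<Sum>j\<in>UNIV. pvar j ^ 2) ^ n))"
proof -
  define q where "q = pconst (1 / \<epsilon>) * p"
  define N where "N = N_expl M t \<epsilon> p"
  have keys: "Poly_Mapping.keys q = Poly_Mapping.keys p"
    using assms(5) by (auto simp: q_def in_keys_iff lookup_pconst_mult)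
  have deg: "pdegree q \<le> 2 * M"
    using assms(2) by (simp add: pdegree_def keys)
  have "peval \<xi> q = peval \<xi> p / \<epsilon>" for \<xi>
    unfolding peval_def keys by (simp add: q_def lookup_pconst_mult sum_divide_distrib)
  then have nonneg: "peval \<xi> q \<ge> 0" for \<xi>
    using assms(5,6) by simp
  have N_int: "int N = max (N_first CARD('d) M) (N_second CARD('d) M t (pnorm q))"
    by (simp add: N_def int_N_expl q_def)
  have N_deg: "2 * M \<le> N"
  proof -
    have "\<lceil>5 * real CARD('d) / 2\<rceil> \<ge> 0" by (simp add: less_le_trans[of _ 0])
    then have "2 * int M \<le> int N" unfolding N_int N_first_def by linarith
    then show ?thesis by linarith
  qed
  have N: "2 * exp 1 * (4 * mu CARD('d) M * pnorm q) powr (1 / (1 - t)) \<le> real N"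
  proof -
    let ?x = "2 * exp 1 * (4 * mu CARD('d) M * pnorm q) powr (1 / (1 - t))"
    have "\<lfloor>3 * real CARD('d) / 2\<rfloor> \<ge> 0" by simp
    moreover have "(if pnorm q = 0 then 0 else max 0 k) \<ge> (0 :: int)" for k by simp
    ultimately have "\<lceil>?x\<rceil> \<le> N_second CARD('d) M t (pnorm q)"
      unfolding N_second_def by (smt (verit))
    then have "\<lceil>?x\<rceil> \<le> int N" unfolding N_int by simp
    then show ?thesis by (simp add: ceiling_le_iff)
  qed
  have "is_sos (pconst \<epsilon> * (q + penalty N t))"
    using assms is_sos_add_penalty[OF assms(1) deg assms(3,4) nonneg N_deg N]
    by (intro is_sos_pconst_mult) auto
  moreover have "pconst \<epsilon> * q = p"
    using assms(5) by (simp add: q_def mult.assoc[symmetric] flip: pconst_mult)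
  ultimately show ?thesis
    by (simp add: distrib_left penalty_def sqn_def N_def)
qed

end
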